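(* For every $\nu>0$, $\eta>0$ and $T>0$ there exist a smooth, divergence-free, zero-average vector field $b_0:\mathbb{T}^2\to\mathbb{R}^2$ and a unique global smooth solution $(u,b)$ of the MHD equations with viscosity $\nu$ and resistivity $\eta$ on $\mathbb{T}^2$ with initial datum $(u(0,\cdot),b(0,\cdot))=(0,b_0)$, such that the magnetic lines at time $t=0$ and at time $t=T$ are not topologically equivalent, i.e. there is no homeomorphism of $\mathbb{T}^2$ onto itself mapping the integral lines of $b(0,\cdot)$ onto the integral lines of $b(T,\cdot)$.
   Context: $\mathbb{T}^2=(\mathbb{R}/2\pi\mathbb{Z})^2$ is the two-dimensional flat torus. The (incompressible) MHD equations with viscosity $\nu$ and resistivity $\eta$ are $$\begin{cases} \partial_t u+(u\cdot \nabla)u+\nabla P=\nu\Delta u+(b\cdot \nabla)b,\\ \partial_t b+(u\cdot \nabla)b=(b\cdot \nabla)u+\eta\Delta b,\\ \operatorname{div} u=\operatorname{div} b=0,\\ u(0,\cdot)=u_0,\quad b(0,\cdot)=b_0, \end{cases}$$ where the unknowns are the velocity $u:[0,\infty)\times\mathbb{T}^2\to\mathbb{R}^2$, the magnetic field $b:[0,\infty)\times\mathbb{T}^2\to\mathbb{R}^2$ and the scalar pressure $P:[0,\infty)\times\mathbb{T}^2\to\mathbb{R}$. A solution is denoted $(u,b)$, the pressure (determined up to an additive function of time) being understood. Global means defined for all $t\ge 0$. A vector field on $\mathbb{T}^2$ has zero average if its integral over $\mathbb{T}^2$ is zero. The magnetic lines at time $t$ are the integral lines (trajectories) of the vector field $b(t,\cdot)$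 at fixed $t$, i.e. the images of the maximal solutions $\gamma$ of $\frac{d}{ds}\gamma(s)=b(t,\gamma(s))$, including stationary points. The magnetic lines at times $t_1$ and $t_2$ are topologically equivalent if there is a homeomorphism of $\mathbb{T}^2$ onto itself mapping each integral line of $b(t_1,\cdot)$ onto an integral line of $b(t_2,\cdot)$. *)

theory Defs
  imports "HOL-Analysis.Analysis"
begin

section \<open>The flat torus\<close>

definition torus_rel :: "real ^ 2 \<Rightarrow> real ^ 2 \<Rightarrow> bool" where
  "torus_rel x y \<longleftrightarrow> (\<forall>i. \<exists>k::int. x $ i - y $ i = 2 * pi * of_int k)"

lemma equivp_torus_rel: "equivp torus_rel"
proof (rule equivpI)
  show "reflp torus_rel"
    by (auto simp: reflp_def torus_rel_def intro: exI[of _ 0])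
  show "symp torus_rel"
  proof (rule sympI)
    fix x y assume a: "torus_rel x y"
    show "torus_rel y x" unfolding torus_rel_def
    proof
      fix i
      from a obtain k :: int where "x $ i - y $ i = 2 * pi * of_int k"
        unfolding torus_rel_def by blast
      then show "\<exists>k::int. y $ i - x $ i = 2 * pi * of_int k"
        by (intro exI[of _ "- k"]) simp
    qed
  qed
  show "transp torus_rel"
  proof (rule transpI)
    fix x y z assume a: "torus_rel x y" "torus_rel y z"
    show "torus_rel x z" unfolding torus_rel_def
    proof
      fix i
      from a obtain k l :: int where "x $ i - y $ i = 2 * pi * of_int k"
        "y $ i - z $ i = 2 * pi * of_int l"
        unfolding torus_rel_def by blast
      then show "\<exists>k::int. x $ i - z $ i = 2 * pi * of_int k"
        by (intro exI[of _ "k + l"]) (simp add: algebra_simps)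
    qed
  qed
qed

quotient_type torus = "real ^ 2" / torus_rel
  morphisms torus_rep torus_of
  by (rule equivp_torus_rel)

text \<open>The quotient topology.\<close>

instantiation torus :: topological_space
begin

definition open_torus :: "torus set \<Rightarrow> bool" where
  "open_torus U \<longleftrightarrow> open (torus_of -` U)"

instance
proof
  show "open (UNIV :: torus set)"
    by (simp add: open_torus_def)
  show "open (S \<inter> T)" if "open S" "open T" for S T :: "torus set"
    using that by (simp add: open_torus_def open_Int)
  show "open (\<Union>K)" if "\<forall>S\<in>K. open S" for K :: "torus set set"
    using that by (auto simp: open_torus_def vimage_Union)
qed

end

lift_definition torus_shift :: "torus \<Rightarrow> real ^ 2 \<Rightarrow> torus" is "\<lambda>x v. x + v"
  by (simp add: torus_rel_def)

section \<open>Calculus on the torus\<close>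

text \<open>For \<open>S\<close> open, or convex with nonempty interior, the Frechet derivative
  within \<open>S\<close> is unique at every point of \<open>S\<close>; at the boundary it is one-sided.\<close>

primrec Ck_on :: "nat \<Rightarrow> 'a::euclidean_space set \<Rightarrow> ('a \<Rightarrow> 'b::real_normed_vector) \<Rightarrow> bool" where
  "Ck_on 0 S f \<longleftrightarrow> continuous_on S f"
| "Ck_on (Suc k) S f \<longleftrightarrow>
     (\<exists>f'. (\<forall>x\<in>S. (f has_derivative f' x) (at x within S)) \<and> (\<forall>v. Ck_on k S (\<lambda>x. f' x v)))"

definition smooth_on :: "'a::euclidean_space set \<Rightarrow> ('a \<Rightarrow> 'b::real_normed_vector) \<Rightarrow> bool" where
  "smooth_on S f \<longleftrightarrow> (\<forall>k. Ck_on k S f)"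

text \<open>Smoothness of functions on the torus, and on \<open>[0,\<infinity>)\<close> times the torus, is smoothness of
  their periodic lifts.  Functions of time are total; only times \<open>t \<ge> 0\<close> are relevant.\<close>

definition torus_smooth :: "(torus \<Rightarrow> 'b::real_normed_vector) \<Rightarrow> bool" where
  "torus_smooth f \<longleftrightarrow> smooth_on UNIV (\<lambda>x. f (torus_of x))"

definition spacetime_smooth :: "(real \<Rightarrow> torus \<Rightarrow> 'b::real_normed_vector) \<Rightarrow> bool" where
  "spacetime_smooth f \<longleftrightarrow> smooth_on ({0..} \<times> UNIV) (\<lambda>(t, x). f t (torus_of x))"

definition pderiv_torus :: "2 \<Rightarrow> (torus \<Rightarrow> 'b::real_normed_vector) \<Rightarrow> torus \<Rightarrow> 'b" where
  "pderiv_torus i f p = vector_derivative (\<lambda>s. f (torus_shift p (s *\<^sub>R axis i 1))) (at 0)"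

definition time_deriv :: "(real \<Rightarrow> torus \<Rightarrow> 'b::real_normed_vector) \<Rightarrow> real \<Rightarrow> torus \<Rightarrow> 'b" where
  "time_deriv f t p = vector_derivative (\<lambda>s. f s p) (at t within {0..})"

definition grad :: "(torus \<Rightarrow> real) \<Rightarrow> torus \<Rightarrow> real ^ 2" where
  "grad f p = (\<chi> i. pderiv_torus i f p)"

definition divergence :: "(torus \<Rightarrow> real ^ 2) \<Rightarrow> torus \<Rightarrow> real" where
  "divergence v p = (\<Sum>i\<in>UNIV. pderiv_torus i v p $ i)"

definition laplacian :: "(torus \<Rightarrow> 'b::real_normed_vector) \<Rightarrow> torus \<Rightarrow> 'b" where
  "laplacian f p = (\<Sum>i\<in>UNIV. pderiv_torus i (pderiv_torus i f) p)"

text \<open>\<open>advect v w\<close> is \<open>(v \<cdot> \<nabla>) w\<close>.\<close>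

definition advect :: "(torus \<Rightarrow> real ^ 2) \<Rightarrow> (torus \<Rightarrow> 'b::real_normed_vector) \<Rightarrow> torus \<Rightarrow> 'b" where
  "advect v w p = (\<Sum>i\<in>UNIV. (v p $ i) *\<^sub>R pderiv_torus i w p)"

definition torus_integral :: "(torus \<Rightarrow> real ^ 2) \<Rightarrow> real ^ 2" where
  "torus_integral f = integral (cbox 0 (\<chi> i. 2 * pi)) (\<lambda>x. f (torus_of x))"

definition zero_average :: "(torus \<Rightarrow> real ^ 2) \<Rightarrow> bool" where
  "zero_average f \<longleftrightarrow> torus_integral f = 0"

section \<open>The MHD equations\<close>

definition global_smooth_MHD_solution ::
  "real \<Rightarrow> real \<Rightarrow> (torus \<Rightarrow> real ^ 2) \<Rightarrow> (torus \<Rightarrow> real ^ 2) \<Rightarrow>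
   (real \<Rightarrow> torus \<Rightarrow> real ^ 2) \<Rightarrow> (real \<Rightarrow> torus \<Rightarrow> real ^ 2) \<Rightarrow> bool" where
  "global_smooth_MHD_solution \<nu> \<eta> u0 b0 u b \<longleftrightarrow>
     spacetime_smooth u \<and> spacetime_smooth b \<and>
     (\<exists>P :: real \<Rightarrow> torus \<Rightarrow> real. spacetime_smooth P \<and>
        (\<forall>t\<ge>0. \<forall>p. time_deriv u t p + advect (u t) (u t) p + grad (P t) p
                     = \<nu> *\<^sub>R laplacian (u t) p + advect (b t) (b t) p)) \<and>
     (\<forall>t\<ge>0. \<forall>p. time_deriv b t p + advect (u t) (b t) p
                  = advect (b t) (u t) p + \<eta> *\<^sub>R laplacian (b t) p) \<and>
     (\<forall>t\<ge>0. \<forall>p. divergence (u t) p = 0 \<and> divergence (b t) p = 0) \<and>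
     u 0 = u0 \<and> b 0 = b0"

section \<open>Integral lines and topological equivalence\<close>

text \<open>The derivative of a curve in the torus, computed in a local lift to the plane.\<close>

definition has_velocity :: "(real \<Rightarrow> torus) \<Rightarrow> real ^ 2 \<Rightarrow> real \<Rightarrow> bool" where
  "has_velocity \<gamma> v s \<longleftrightarrow>
     (\<exists>c. (c has_vector_derivative v) (at s) \<and> (\<forall>\<^sub>F r in nhds s. \<gamma> r = torus_of (c r)))"

definition integral_curve :: "(torus \<Rightarrow> real ^ 2) \<Rightarrow> real set \<Rightarrow> (real \<Rightarrow> torus) \<Rightarrow> bool" where
  "integral_curve X J \<gamma> \<longleftrightarrow>
     open J \<and> is_interval J \<and> J \<noteq> {} \<and> (\<forall>s\<in>J. has_velocity \<gamma> (X (\<gamma> s)) s)"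

text \<open>Values of \<open>\<gamma>\<close> outside the interval \<open>J\<close> are irrelevant.\<close>

definition maximal_integral_curve :: "(torus \<Rightarrow> real ^ 2) \<Rightarrow> real set \<Rightarrow> (real \<Rightarrow> torus) \<Rightarrow> bool" where
  "maximal_integral_curve X J \<gamma> \<longleftrightarrow>
     integral_curve X J \<gamma> \<and>
     (\<forall>J' \<gamma>'. integral_curve X J' \<gamma>' \<and> J \<subseteq> J' \<and> (\<forall>s\<in>J. \<gamma>' s = \<gamma> s) \<longrightarrow> J' = J)"

definition integral_lines :: "(torus \<Rightarrow> real ^ 2) \<Rightarrow> torus set set" where
  "integral_lines X = {\<gamma> ` J | J \<gamma>. maximal_integral_curve X J \<gamma>}"

definition lines_topologically_equivalent ::
  "(torus \<Rightarrow> real ^ 2) \<Rightarrow> (torus \<Rightarrow> real ^ 2) \<Rightarrow> bool" where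
  "lines_topologically_equivalent X Y \<longleftrightarrow>
     (\<exists>h h'. homeomorphism UNIV UNIV h h' \<and> (\<forall>L\<in>integral_lines X. h ` L \<in> integral_lines Y))"

end

theory Submission
  imports Defs
begin

text \<open>
  The magnetic field is a shear composed of two Fourier modes.  A field
  \<open>b(t, x) = (0, g(t, x\<^sub>1))\<close> satisfies \<open>(b \<cdot> \<nabla>) b = 0\<close>, so it exerts no force on a fluid at rest:
  if \<open>g\<close> solves the heat equation with diffusivity \<open>\<eta>\<close>, then \<open>(0, b)\<close> with zero pressure solves
  the MHD equations (\<open>shear_is_solution\<close>).  With \<open>\<kappa> = exp (- 3 \<eta> T)\<close> take
  \<open>g(t, x\<^sub>1) = exp (- \<eta> t) \<kappa> sin x\<^sub>1 + exp (- 4 \<eta> t) sin x\<^sub>1 cos x\<^sub>1\<close>, which up to a positive factor is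
  \<open>sin x\<^sub>1 (\<kappa> exp (3 \<eta> t) + cos x\<^sub>1)\<close>.  The second mode decays faster than the first.  At time \<open>0\<close> the
  field vanishes on the four circles \<open>x\<^sub>1 = 0\<close>, \<open>x\<^sub>1 = \<pi>\<close> and \<open>cos x\<^sub>1 = - \<kappa>\<close>; at time \<open>T\<close>, where
  \<open>\<kappa> exp (3 \<eta> T) = 1\<close>, only the two circles \<open>sin x\<^sub>1 = 0\<close> remain.

  The number of circles of zeros is an invariant of the magnetic lines.  For a shear field the line through a
  zero is a single point and every other line has more than one point (\<open>line_singleton_iff\<close>), so a
  homeomorphism that maps lines onto lines maps the zero set onto the zero set (\<open>zeros_correspond\<close>).
  If \<open>h\<close> were such a homeomorphism with inverse \<open>h'\<close>, \<open>cos x\<^sub>1 \<circ> h'\<close> would take the values \<open>1\<close>, \<open>-1\<close>, \<open>- \<kappa>\<close> and no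
  others on the zero set at time \<open>T\<close>, and it would be constant on each of the two connected
  circles there; three values cannot be taken on two circles (\<open>no_four_circles_onto_two\<close>).

  Uniqueness is the classical energy estimate (\<open>shear_solution_unique\<close>).  For another smooth solution
  \<open>(u, b')\<close> with the same initial data put \<open>B = b' - b\<close> and
  \<open>e = |u|\<^sup>2 + |B|\<^sup>2\<close>.  The time derivative of \<open>e\<close> is a divergence, minus
  dissipation, plus \<open>2 \<partial>\<^sub>1g (B\<^sub>1 u\<^sub>2 - u\<^sub>1 B\<^sub>2)\<close>.  The divergence integrates to zero over the torus, and
  the last term is at most \<open>e\<close> times a bound for \<open>\<partial>\<^sub>1g\<close>.  By Gronwall's inequality the integral of
  \<open>e\<close> vanishes at all times.
\<close>

section \<open>Closure properties of differentiability classes\<close>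

lemma Ck_on_cong:
  assumes "\<And>z. z \<in> S \<Longrightarrow> f z = g z" and "Ck_on k S f"
  shows "Ck_on k S g"
proof (cases k)
  case 0
  then show ?thesis using assms continuous_on_cong[of S S f g] by simp
next
  case (Suc m)
  then obtain f' where f': "\<forall>x\<in>S. (f has_derivative f' x) (at x within S)"
    "\<forall>v. Ck_on m S (\<lambda>x. f' x v)" using assms(2) by auto
  have "\<forall>x\<in>S. (g has_derivative f' x) (at x within S)"
    using f'(1) assms(1) by (metis has_derivative_transform)
  then show ?thesis using f'(2) Suc by auto
qed

text \<open>The product rule expresses the derivative of a product through the factors themselves,
  so the induction for products loses one order of differentiability on them.\<close>

lemma Ck_on_SucD: "Ck_on (Suc k) S f \<Longrightarrow> Ck_on k S f"
proof (induction k arbitrary: f)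
  case 0
  then show ?case by (auto intro: has_derivative_continuous_on)
next
  case (Suc k)
  then obtain f' where f': "\<forall>x\<in>S. (f has_derivative f' x) (at x within S)"
    "\<forall>v. Ck_on (Suc k) S (\<lambda>x. f' x v)" by (auto simp del: Ck_on.simps simp: Ck_on.simps(2)[of "Suc k"])
  then show ?case using Suc.IH by auto
qed

lemma Ck_on_const: "Ck_on k S (\<lambda>z. c)"
proof (induction k arbitrary: c)
  case (Suc k)
  show ?case unfolding Ck_on.simps
    by (intro exI[of _ "\<lambda>_ _. 0"] conjI ballI allI has_derivative_const Suc)
qed simp

lemma Ck_on_bounded_linear:
  assumes "bounded_linear h"
  shows "Ck_on k S f \<Longrightarrow> Ck_on k S (\<lambda>z. h (f z))"
proof (induction k arbitrary: f)
  case 0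
  then show ?case using bounded_linear.continuous_on[OF assms] by auto
next
  case (Suc k)
  then obtain f' where f': "\<forall>x\<in>S. (f has_derivative f' x) (at x within S)"
    "\<forall>v. Ck_on k S (\<lambda>x. f' x v)" by auto
  have "\<forall>x\<in>S. ((\<lambda>z. h (f z)) has_derivative (\<lambda>v. h (f' x v))) (at x within S)"
    using f'(1) bounded_linear.has_derivative[OF assms] by blast
  then show ?case using f'(2) Suc.IH by auto
qed

lemma Ck_on_add:
  "Ck_on k S f \<Longrightarrow> Ck_on k S g \<Longrightarrow> Ck_on k S (\<lambda>z. f z + g z)"
proof (induction k arbitrary: f g)
  case 0
  then show ?case by (auto intro: continuous_on_add)
next
  case (Suc k)
  then obtain f' g' where f': "\<forall>x\<in>S. (f has_derivative f' x) (at x within S)"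
    "\<forall>v. Ck_on k S (\<lambda>x. f' x v)" and g': "\<forall>x\<in>S. (g has_derivative g' x) (at x within S)"
    "\<forall>v. Ck_on k S (\<lambda>x. g' x v)" by auto
  have "\<forall>x\<in>S. ((\<lambda>z. f z + g z) has_derivative (\<lambda>v. f' x v + g' x v)) (at x within S)"
    using f'(1) g'(1) by (auto intro: has_derivative_add)
  then show ?case using f'(2) g'(2) Suc.IH by auto
qed

lemma Ck_on_mult:
  fixes f g :: "'a::euclidean_space \<Rightarrow> real"
  shows "Ck_on k S f \<Longrightarrow> Ck_on k S g \<Longrightarrow> Ck_on k S (\<lambda>z. f z * g z)"
proof (induction k arbitrary: f g)
  case 0
  then show ?case by (auto intro: continuous_on_mult)
next
  case (Suc k)
  then obtain f' g' where f': "\<forall>x\<in>S. (f has_derivative f' x) (at x within S)"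
    "\<forall>v. Ck_on k S (\<lambda>x. f' x v)" and g': "\<forall>x\<in>S. (g has_derivative g' x) (at x within S)"
    "\<forall>v. Ck_on k S (\<lambda>x. g' x v)" by auto
  have "\<forall>x\<in>S. ((\<lambda>z. f z * g z) has_derivative (\<lambda>v. f x * g' x v + f' x v * g x)) (at x within S)"
    using f'(1) g'(1) by (auto intro: has_derivative_mult)
  moreover have "Ck_on k S (\<lambda>x. f x * g' x v + f' x v * g x)" for v
    using f'(2) g'(2) Suc.prems[THEN Ck_on_SucD] by (intro Ck_on_add Suc.IH) auto
  ultimately show ?case
    by (auto intro!: exI[of _ "\<lambda>x v. f x * g' x v + f' x v * g x"])
qed

text \<open>One chain rule serves three purposes: freezing the time of a function on spacetime,
  regarding a function of space or of time as a function on spacetime,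
  and composing \<open>sin\<close>, \<open>cos\<close> and \<open>exp\<close> with linear forms.\<close>

lemma Ck_on_compose_affine:
  fixes h :: "'a::euclidean_space \<Rightarrow> 'c::euclidean_space"
  assumes h: "bounded_linear h" and T: "\<And>z. z \<in> S \<Longrightarrow> c + h z \<in> T"
  shows "Ck_on k T f \<Longrightarrow> Ck_on k S (\<lambda>z. f (c + h z))"
proof (induction k arbitrary: f)
  case 0
  then have "continuous_on T f" by simp
  moreover have "continuous_on S (\<lambda>z. c + h z)"
    by (intro continuous_intros linear_continuous_on h)
  ultimately show ?case using T by (auto intro: continuous_on_compose2)
next
  case (Suc k)
  then obtain f' where f': "\<forall>x\<in>T. (f has_derivative f' x) (at x within T)"
    "\<forall>v. Ck_on k T (\<lambda>x. f' x v)" by auto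
  have "((\<lambda>z. f (c + h z)) has_derivative (\<lambda>v. f' (c + h x) (h v))) (at x within S)"
    if "x \<in> S" for x
  proof -
    have "((\<lambda>z. c + h z) has_derivative h) (at x within S)"
      by (auto intro!: derivative_eq_intros bounded_linear_imp_has_derivative h)
    moreover have "(f has_derivative f' (c + h x)) (at (c + h x) within (\<lambda>z. c + h z) ` S)"
      using f'(1) T that by (blast intro: has_derivative_subset)
    ultimately show ?thesis by (rule has_derivative_in_compose)
  qed
  moreover have "Ck_on k S (\<lambda>x. f' (c + h x) (h v))" for v
    using Suc.IH f'(2) by blast
  ultimately show ?case
    by (auto intro!: exI[of _ "\<lambda>x v. f' (c + h x) (h v)"])
qed

lemma Ck_on_exp: "Ck_on k S (exp :: real \<Rightarrow> real)"
proof (induction k)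
  case (Suc k)
  have "\<forall>x\<in>S. (exp has_derivative (\<lambda>v. v * exp x)) (at x within S)"
    by (auto intro!: derivative_eq_intros)
  then show ?case using Suc by (auto intro!: exI[of _ "\<lambda>x v. v * exp x"] Ck_on_mult Ck_on_const)
qed (auto intro!: continuous_intros)

lemma Ck_on_sin_cos:
  "Ck_on k S (sin :: real \<Rightarrow> real) \<and> Ck_on k S (cos :: real \<Rightarrow> real)"
proof (induction k)
  case (Suc k)
  have "\<forall>x\<in>S. (sin has_derivative (\<lambda>v. v * cos x)) (at x within S)"
    "\<forall>x\<in>S. (cos has_derivative (\<lambda>v. - v * sin x)) (at x within S)"
    by (auto intro!: derivative_eq_intros)
  then show ?case unfolding Ck_on.simps using Suc
    by (intro conjI exI[of _ "\<lambda>x v. v * cos x"] exI[of _ "\<lambda>x v. - v * sin x"] allI Ck_on_mult Ck_on_const)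
      auto
qed (auto intro!: continuous_intros)

section \<open>Smooth functions on the torus and on spacetime\<close>

abbreviation spacetime :: "(real \<times> (real ^ 2)) set" where
  "spacetime \<equiv> {0..} \<times> UNIV"

lemma spacetime_smooth_slice:
  assumes "spacetime_smooth f" "t \<ge> 0"
  shows "torus_smooth (f t)"
  using assms Ck_on_compose_affine[of "\<lambda>x. (0::real, x)" UNIV "(t, 0)" spacetime _ "\<lambda>(t, x). f t (torus_of x)"]
  unfolding torus_smooth_def spacetime_smooth_def smooth_on_def
  by (simp add: bounded_linear_Pair bounded_linear_zero bounded_linear_ident)

lemma torus_smooth_add:
  "torus_smooth f \<Longrightarrow> torus_smooth g \<Longrightarrow> torus_smooth (\<lambda>p. f p + g p)"
  unfolding torus_smooth_def smooth_on_def by (simp add: Ck_on_add)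

lemma torus_smooth_mult:
  fixes f g :: "torus \<Rightarrow> real"
  shows "torus_smooth f \<Longrightarrow> torus_smooth g \<Longrightarrow> torus_smooth (\<lambda>p. f p * g p)"
  unfolding torus_smooth_def smooth_on_def by (simp add: Ck_on_mult)

lemma torus_smooth_const: "torus_smooth (\<lambda>p. c)"
  unfolding torus_smooth_def smooth_on_def by (simp add: Ck_on_const)

lemma spacetime_smooth_bounded_linear:
  "bounded_linear h \<Longrightarrow> spacetime_smooth f \<Longrightarrow> spacetime_smooth (\<lambda>t p. h (f t p))"
  unfolding spacetime_smooth_def smooth_on_def
  using Ck_on_bounded_linear[of h _ spacetime "\<lambda>(t, x). f t (torus_of x)"]
  by (simp add: case_prod_unfold)

lemma spacetime_smooth_nth:
  "spacetime_smooth v \<Longrightarrow> spacetime_smooth (\<lambda>t p. v t p $ i)"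
  by (rule spacetime_smooth_bounded_linear[OF bounded_linear_vec_nth])

lemma spacetime_smooth_const: "spacetime_smooth (\<lambda>t p. c)"
  unfolding spacetime_smooth_def smooth_on_def by (simp add: Ck_on_const case_prod_unfold)

lemma spacetime_smooth_add:
  "spacetime_smooth f \<Longrightarrow> spacetime_smooth g \<Longrightarrow> spacetime_smooth (\<lambda>t p. f t p + g t p)"
  unfolding spacetime_smooth_def smooth_on_def by (simp add: Ck_on_add case_prod_unfold)

lemma spacetime_smooth_mult:
  fixes f g :: "real \<Rightarrow> torus \<Rightarrow> real"
  shows "spacetime_smooth f \<Longrightarrow> spacetime_smooth g \<Longrightarrow> spacetime_smooth (\<lambda>t p. f t p * g t p)"
  unfolding spacetime_smooth_def smooth_on_def by (simp add: Ck_on_mult case_prod_unfold)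

lemma spacetime_smooth_diff:
  fixes f g :: "real \<Rightarrow> torus \<Rightarrow> real"
  assumes "spacetime_smooth f" "spacetime_smooth g"
  shows "spacetime_smooth (\<lambda>t p. f t p - g t p)"
  using spacetime_smooth_add[OF assms(1) spacetime_smooth_mult[OF spacetime_smooth_const[of "-1"] assms(2)]]
  by simp

lemma torus_of_eq_iff: "torus_of x = torus_of y \<longleftrightarrow> torus_rel x y"
  using torus.abs_eq_iff by blast

lemma torus_of_surj: "\<exists>x. p = torus_of x"
  by (metis Quotient_abs_rep[OF Quotient_torus])

lemma torus_has_derivative_along_axis:
  assumes F': "((\<lambda>x. f (torus_of x)) has_derivative F') (at x)"
  shows "((\<lambda>s. f (torus_shift (torus_of x) (s *\<^sub>R axis i 1))) has_vector_derivative F' (axis i 1)) (at 0)"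
proof -
  let ?c = "\<lambda>s::real. x + s *\<^sub>R axis i 1"
  have "(?c has_vector_derivative axis i 1) (at 0)"
    unfolding has_vector_derivative_def by (auto intro!: derivative_eq_intros)
  moreover have "((\<lambda>x. f (torus_of x)) has_derivative F') (at (?c 0) within range ?c)"
    using has_derivative_at_withinI[OF F'] by simp
  ultimately have "((\<lambda>x. f (torus_of x)) \<circ> ?c has_vector_derivative F' (axis i 1)) (at 0)"
    by (rule vector_derivative_diff_chain_within)
  then show ?thesis
    by (simp add: o_def torus_shift.abs_eq)
qed

lemma torus_derivative_along_axis:
  "((\<lambda>x. f (torus_of x)) has_derivative F') (at x) \<Longrightarrow> pderiv_torus i f (torus_of x) = F' (axis i 1)"
  unfolding pderiv_torus_def by (intro vector_derivative_at torus_has_derivative_along_axis)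

lemma torus_smooth_has_pderiv:
  assumes "torus_smooth f"
  shows "((\<lambda>s. f (torus_shift p (s *\<^sub>R axis i 1))) has_vector_derivative pderiv_torus i f p) (at 0)"
proof -
  obtain x where p: "p = torus_of x" using torus_of_surj by blast
  have "Ck_on (Suc 0) UNIV (\<lambda>x. f (torus_of x))"
    using assms unfolding torus_smooth_def smooth_on_def by blast
  then obtain F' where F': "((\<lambda>x. f (torus_of x)) has_derivative F') (at x)"
    by auto
  show ?thesis
    using torus_has_derivative_along_axis[OF F'] torus_derivative_along_axis[OF F'] p by metis
qed

lemma torus_smooth_pderiv:
  assumes "torus_smooth f"
  shows "torus_smooth (pderiv_torus i f)"
  unfolding torus_smooth_def smooth_on_def
proof
  fix k
  have "Ck_on (Suc k) UNIV (\<lambda>x. f (torus_of x))"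
    using assms unfolding torus_smooth_def smooth_on_def by blast
  then obtain F' where F': "\<And>x. ((\<lambda>x. f (torus_of x)) has_derivative F' x) (at x)"
    "\<And>v. Ck_on k UNIV (\<lambda>x. F' x v)" by auto
  show "Ck_on k UNIV (\<lambda>x. pderiv_torus i f (torus_of x))"
    by (rule Ck_on_cong[OF _ F'(2)[of "axis i 1"]])
      (simp add: torus_derivative_along_axis[OF F'(1)])
qed

lemma spacetime_derivative_along_time:
  assumes F: "((\<lambda>(t, x). f t (torus_of x)) has_derivative F') (at (t, x) within spacetime)"
    and t: "t \<ge> 0"
  shows "((\<lambda>s. f s (torus_of x)) has_vector_derivative F' (1, 0)) (at t within {0..})"
proof -
  let ?F = "\<lambda>(t, x). f t (torus_of x)" and ?d = "\<lambda>s::real. (s, x)"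
  have "(?d has_vector_derivative (1, 0)) (at t within {0..})"
    unfolding has_vector_derivative_def
    by (auto intro!: derivative_eq_intros)
  moreover have "(?F has_derivative F') (at (?d t) within ?d ` {0..})"
    using has_derivative_subset[OF F, of "?d ` {0..}"] t by auto
  ultimately have "((?F \<circ> ?d) has_vector_derivative F' (1, 0)) (at t within {0..})"
    by (rule vector_derivative_diff_chain_within)
  then show ?thesis
    by (simp add: o_def)
qed

lemma spacetime_derivative_along_axis:
  assumes F: "((\<lambda>(t, x). f t (torus_of x)) has_derivative F') (at (t, x) within spacetime)"
    and t: "t \<ge> 0"
  shows "pderiv_torus i (f t) (torus_of x) = F' (0, axis i 1)"
proof -
  let ?F = "\<lambda>(t, x). f t (torus_of x)" and ?c = "\<lambda>s::real. (t, x + s *\<^sub>R axis i 1)"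
  have "(?c has_vector_derivative (0, axis i 1)) (at 0)"
    unfolding has_vector_derivative_def
    by (auto intro!: derivative_eq_intros)
  moreover have "(?F has_derivative F') (at (?c 0) within ?c ` UNIV)"
    using has_derivative_subset[OF F, of "?c ` UNIV"] t by auto
  ultimately have "((?F \<circ> ?c) has_vector_derivative F' (0, axis i 1)) (at 0)"
    by (rule vector_derivative_diff_chain_within)
  then show ?thesis
    unfolding pderiv_torus_def
    by (intro vector_derivative_at) (simp add: o_def torus_shift.abs_eq)
qed

text \<open>This makes the time derivative unique, including the one-sided one at time \<open>0\<close>.\<close>

lemma at_within_half_line_nontrivial: "t \<ge> 0 \<Longrightarrow> at t within {0..} \<noteq> (bot :: real filter)"
  using islimpt_greaterThanLessThan1[of t "t+1"] islimpt_subset[of t "{t<..<t+1}" "{0..}"]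
  by (force simp: trivial_limit_within)

text \<open>The derivative supplied by \<open>Ck_on\<close> may depend on the order \<open>k\<close>, but its value in a
  coordinate direction is always the partial derivative, so one function works for all orders.\<close>

lemma spacetime_smooth_pderiv:
  assumes "spacetime_smooth f"
  shows "spacetime_smooth (\<lambda>t. pderiv_torus i (f t))"
  unfolding spacetime_smooth_def smooth_on_def
proof
  fix k
  have "Ck_on (Suc k) spacetime (\<lambda>(t, x). f t (torus_of x))"
    using assms unfolding spacetime_smooth_def smooth_on_def by blast
  then obtain F' where F': "\<forall>z\<in>spacetime. ((\<lambda>(t, x). f t (torus_of x)) has_derivative F' z) (at z within spacetime)"
    "\<forall>v. Ck_on k spacetime (\<lambda>z. F' z v)" by auto
  show "Ck_on k spacetime (\<lambda>(t, x). pderiv_torus i (f t) (torus_of x))"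
    by (rule Ck_on_cong[OF _ F'(2)[rule_format, of "(0, axis i 1)"]])
      (clarsimp simp: spacetime_derivative_along_axis[OF F'(1)[rule_format]])
qed

lemma spacetime_smooth_has_time_deriv:
  assumes "spacetime_smooth f" and t: "t \<ge> 0"
  shows "((\<lambda>s. f s p) has_vector_derivative time_deriv f t p) (at t within {0..})"
proof -
  obtain x where p: "p = torus_of x" using torus_of_surj by blast
  have "Ck_on (Suc 0) spacetime (\<lambda>(t, x). f t (torus_of x))"
    using assms unfolding spacetime_smooth_def smooth_on_def by blast
  then obtain F' where F': "((\<lambda>(t, x). f t (torus_of x)) has_derivative F') (at (t, x) within spacetime)"
    using t by auto
  show ?thesis
    using spacetime_derivative_along_time[OF F' t] p
      vector_derivative_within[OF at_within_half_line_nontrivial[OF t]]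
    unfolding time_deriv_def by metis
qed

lemma time_deriv_eqI:
  assumes "((\<lambda>s. f s p) has_vector_derivative d) (at t within {0..})" "t \<ge> 0"
  shows "time_deriv f t p = d"
  unfolding time_deriv_def
  using assms by (intro vector_derivative_within at_within_half_line_nontrivial)

lemma spacetime_smooth_time_deriv:
  assumes "spacetime_smooth f"
  shows "spacetime_smooth (time_deriv f)"
  unfolding spacetime_smooth_def smooth_on_def
proof
  fix k
  have "Ck_on (Suc k) spacetime (\<lambda>(t, x). f t (torus_of x))"
    using assms unfolding spacetime_smooth_def smooth_on_def by blast
  then obtain F' where F': "\<forall>z\<in>spacetime. ((\<lambda>(t, x). f t (torus_of x)) has_derivative F' z) (at z within spacetime)"
    "\<forall>v. Ck_on k spacetime (\<lambda>z. F' z v)" by auto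
  have "time_deriv f t (torus_of x) = F' (t, x) (1, 0)" if "t \<ge> 0" for t x
    using F'(1) that by (intro time_deriv_eqI spacetime_derivative_along_time) auto
  then show "Ck_on k spacetime (\<lambda>(t, x). time_deriv f t (torus_of x))"
    by (intro Ck_on_cong[OF _ F'(2)[rule_format, of "(1, 0)"]]) auto
qed

lemma pderiv_torus_nth:
  assumes "torus_smooth v"
  shows "pderiv_torus i (\<lambda>p. v p $ j) p = pderiv_torus i v p $ j"
  unfolding pderiv_torus_def[of i "\<lambda>p. v p $ j"]
  by (intro vector_derivative_at bounded_linear.has_vector_derivative[OF bounded_linear_vec_nth]
      torus_smooth_has_pderiv assms)

lemma pderiv_torus_add:
  assumes "torus_smooth f" "torus_smooth g"
  shows "pderiv_torus i (\<lambda>p. f p + g p) p = pderiv_torus i f p + pderiv_torus i g p"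
  unfolding pderiv_torus_def[of i "\<lambda>p. f p + g p"]
  by (intro vector_derivative_at has_vector_derivative_add
      torus_smooth_has_pderiv assms)

lemma torus_shift_0: "torus_shift p 0 = p"
  by transfer (auto simp: torus_rel_def intro: exI[of _ 0])

lemma pderiv_torus_mult:
  fixes f g :: "torus \<Rightarrow> real"
  assumes "torus_smooth f" "torus_smooth g"
  shows "pderiv_torus i (\<lambda>p. f p * g p) p = f p * pderiv_torus i g p + pderiv_torus i f p * g p"
  unfolding pderiv_torus_def[of i "\<lambda>p. f p * g p"]
  using has_vector_derivative_mult[OF torus_smooth_has_pderiv[OF assms(1), of p i] torus_smooth_has_pderiv[OF assms(2), of p i]]
  by (intro vector_derivative_at) (simp add: torus_shift_0)

lemma pderiv_torus_const: "pderiv_torus i (\<lambda>p. c) p = 0"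
  unfolding pderiv_torus_def by simp

section \<open>Coordinates\<close>

definition torus_pt :: "real \<Rightarrow> real \<Rightarrow> torus" where
  "torus_pt x y = torus_of (vector [x, y])"

lemma torus_pt_nth: "torus_of x = torus_pt (x $ 1) (x $ 2)"
proof -
  have "x = vector [x $ 1, x $ 2]" by (simp add: vec_eq_iff forall_2)
  then show ?thesis unfolding torus_pt_def by metis
qed

lemma torus_shift_torus_pt:
  "torus_shift (torus_pt x y) (s *\<^sub>R axis 1 1) = torus_pt (x + s) y"
  "torus_shift (torus_pt x y) (s *\<^sub>R axis 2 1) = torus_pt x (y + s)"
proof -
  have "vector [x, y] + s *\<^sub>R axis 1 1 = (vector [x + s, y] :: real ^ 2)"
    "vector [x, y] + s *\<^sub>R axis 2 1 = (vector [x, y + s] :: real ^ 2)"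
    by (auto simp: vec_eq_iff forall_2 axis_def)
  then show "torus_shift (torus_pt x y) (s *\<^sub>R axis 1 1) = torus_pt (x + s) y"
    "torus_shift (torus_pt x y) (s *\<^sub>R axis 2 1) = torus_pt x (y + s)"
    by (auto simp: torus_pt_def torus_shift.abs_eq)
qed

lemma torus_pt_eq_iff:
  "torus_pt x y = torus_pt x' y' \<longleftrightarrow> (\<exists>k::int. x - x' = 2 * pi * k) \<and> (\<exists>k::int. y - y' = 2 * pi * k)"
  by (simp add: torus_pt_def torus_of_eq_iff torus_rel_def forall_2)

lemma torus_pt_periodic: "torus_pt (2 * pi) y = torus_pt 0 y" "torus_pt x (2 * pi) = torus_pt x 0"
  unfolding torus_pt_eq_iff by (auto intro: exI[of _ 0] exI[of _ 1])

text \<open>The closed box meets every class, so information on the box is information on the whole torus.\<close>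

lemma torus_pt_in_box:
  obtains x y where "p = torus_pt x y" "(x, y) \<in> cbox (0, 0) (2 * pi, 2 * pi)"
proof -
  obtain z where z: "p = torus_of z" using torus_of_surj by blast
  define r where "r a = a - 2 * pi * of_int \<lfloor>a / (2 * pi)\<rfloor>" for a :: real
  have r: "0 \<le> r a" "r a \<le> 2 * pi" for a
    using floor_divide_lower[of "2 * pi" a] floor_divide_upper[of "2 * pi" a]
    by (auto simp: r_def algebra_simps)
  have "p = torus_pt (r (z $ 1)) (r (z $ 2))"
    unfolding z torus_pt_nth torus_pt_eq_iff r_def by auto
  then show ?thesis using that r by auto
qed

lemma torus_smooth_has_real_derivative:
  fixes f :: "torus \<Rightarrow> real"
  assumes f: "torus_smooth f"
  shows "((\<lambda>x. f (torus_pt x y)) has_real_derivative pderiv_torus 1 f (torus_pt x y)) (at x)"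
    and "((\<lambda>y. f (torus_pt x y)) has_real_derivative pderiv_torus 2 f (torus_pt x y)) (at y)"
  using torus_smooth_has_pderiv[OF f, of "torus_pt x y" 1]
    torus_smooth_has_pderiv[OF f, of "torus_pt x y" 2]
    DERIV_at_within_shift[of "\<lambda>x. f (torus_pt x y)" _ x 0 UNIV]
    DERIV_at_within_shift[of "\<lambda>y. f (torus_pt x y)" _ y 0 UNIV]
  by (simp_all add: torus_shift_torus_pt has_real_derivative_iff_has_vector_derivative add.commute)

lemma continuous_on_torus_pt_lift: "continuous_on S (\<lambda>(x, y). vector [x, y] :: real ^ 2)"
proof -
  have "vector [x, y] = x *\<^sub>R axis 1 1 + y *\<^sub>R (axis 2 1 :: real ^ 2)" for x y :: real
    by (simp add: vec_eq_iff forall_2 axis_def)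
  then show ?thesis
    by (simp add: case_prod_unfold) (intro continuous_intros)
qed

lemma torus_smooth_continuous:
  fixes f :: "torus \<Rightarrow> 'b::real_normed_vector"
  assumes "torus_smooth f"
  shows "continuous_on S (\<lambda>(x, y). f (torus_pt x y))"
proof -
  have "Ck_on 0 UNIV (\<lambda>x. f (torus_of x))"
    using assms unfolding torus_smooth_def smooth_on_def by blast
  then show ?thesis
    using continuous_on_compose2[OF _ continuous_on_torus_pt_lift, of UNIV "\<lambda>x. f (torus_of x)" S]
    by (simp add: case_prod_unfold torus_pt_def)
qed

lemma spacetime_smooth_continuous:
  fixes f :: "real \<Rightarrow> torus \<Rightarrow> 'b::real_normed_vector"
  assumes "spacetime_smooth f" "S \<subseteq> {0..} \<times> UNIV"
  shows "continuous_on S (\<lambda>(t, x, y). f t (torus_pt x y))"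
proof -
  have "Ck_on 0 spacetime (\<lambda>(t, x). f t (torus_of x))"
    using assms unfolding spacetime_smooth_def smooth_on_def by blast
  then have 1: "continuous_on spacetime (\<lambda>(t, x). f t (torus_of x))" by simp
  have 2: "continuous_on S (\<lambda>(t::real, x, y). (t, vector [x, y] :: real ^ 2))"
    using continuous_on_compose2[OF continuous_on_torus_pt_lift continuous_on_snd[OF continuous_on_id]]
    by (auto simp: case_prod_unfold intro!: continuous_intros)
  show ?thesis
    using continuous_on_compose2[OF 1 2] assms(2)
    by (force simp: case_prod_unfold torus_pt_def)
qed

section \<open>Integration over the torus\<close>

text \<open>With the box in \<open>real \<times> real\<close> instead of \<open>real ^ 2\<close>, Fubini's theorem applies directly.\<close>

definition torus_mass :: "(torus \<Rightarrow> real) \<Rightarrow> real" where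
  "torus_mass f = integral (cbox (0, 0) (2 * pi, 2 * pi)) (\<lambda>(x, y). f (torus_pt x y))"

lemma torus_smooth_integrable:
  "torus_smooth f \<Longrightarrow> (\<lambda>(x, y). f (torus_pt x y) :: real) integrable_on cbox (a, b) (c, d)"
  by (intro integrable_continuous torus_smooth_continuous)

lemma torus_mass_add:
  "torus_smooth f \<Longrightarrow> torus_smooth g \<Longrightarrow> torus_mass (\<lambda>p. f p + g p) = torus_mass f + torus_mass g"
  unfolding torus_mass_def
  using integral_add[OF torus_smooth_integrable[of f] torus_smooth_integrable[of g]]
  by (simp add: case_prod_unfold)

lemma torus_mass_cmult: "torus_mass (\<lambda>p. c * f p) = c * torus_mass f"
  unfolding torus_mass_def by (simp add: case_prod_unfold)

lemma torus_mass_mono: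
  "torus_smooth f \<Longrightarrow> torus_smooth g \<Longrightarrow> (\<And>p. f p \<le> g p) \<Longrightarrow> torus_mass f \<le> torus_mass g"
  unfolding torus_mass_def
  by (intro integral_le torus_smooth_integrable) auto

lemma torus_mass_eq_0_imp:
  assumes f: "torus_smooth f" "\<And>p. f p \<ge> 0" and 0: "torus_mass f = 0"
  shows "f p = 0"
proof -
  obtain x y where p: "p = torus_pt x y" "(x, y) \<in> cbox (0, 0) (2 * pi, 2 * pi)"
    by (rule torus_pt_in_box)
  have "((\<lambda>(x, y). f (torus_pt x y)) has_integral 0) (cbox (0, 0) (2 * pi, 2 * pi))"
    using 0 torus_smooth_integrable[OF f(1)] unfolding torus_mass_def by (metis integrable_integral)
  moreover have "box (0, 0) (2 * pi, 2 * pi) \<noteq> ({} :: (real \<times> real) set)"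
    by (auto simp: box_ne_empty Basis_prod_def)
  ultimately have "(\<lambda>(x, y). f (torus_pt x y)) (x, y) = 0"
    using has_integral_0_cbox_imp_0[OF torus_smooth_continuous[OF f(1)]] f(2) p(2)
    by fastforce
  then show ?thesis using p by simp
qed

text \<open>The divergence theorem on a closed manifold: after Fubini, the integral along the \<open>i\<close>-th circle is the
  difference of equal boundary values.\<close>

lemma torus_mass_pderiv:
  assumes f: "torus_smooth f"
  shows "torus_mass (pderiv_torus i f) = 0"
proof -
  note cont = torus_smooth_continuous[OF torus_smooth_pderiv[OF f, of i], of "cbox (0, 0) (2 * pi, 2 * pi)"]
  have "((\<lambda>x. pderiv_torus 1 f (torus_pt x y)) has_integral f (torus_pt (2 * pi) y) - f (torus_pt 0 y)) {0..2 * pi}"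
    for y
    by (intro fundamental_theorem_of_calculus)
      (auto intro: has_field_derivative_at_within torus_smooth_has_real_derivative[OF f]
        simp flip: has_real_derivative_iff_has_vector_derivative)
  then have 1: "integral {0..2 * pi} (\<lambda>x. pderiv_torus 1 f (torus_pt x y)) = 0" for y
    by (simp add: integral_unique torus_pt_periodic)
  have "((\<lambda>y. pderiv_torus 2 f (torus_pt x y)) has_integral f (torus_pt x (2 * pi)) - f (torus_pt x 0)) {0..2 * pi}"
    for x
    by (intro fundamental_theorem_of_calculus)
      (auto intro: has_field_derivative_at_within torus_smooth_has_real_derivative[OF f]
        simp flip: has_real_derivative_iff_has_vector_derivative)
  then have 2: "integral {0..2 * pi} (\<lambda>y. pderiv_torus 2 f (torus_pt x y)) = 0" for x
    by (simp add: integral_unique torus_pt_periodic)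
  show ?thesis
    using exhaust_2[of i]
  proof
    assume "i = 1"
    then show ?thesis
      using integral_prod_continuous[OF cont] 1 integral_swap_continuous[OF cont]
      unfolding torus_mass_def by simp
  next
    assume "i = 2"
    then show ?thesis
      using integral_prod_continuous[OF cont] 2
      unfolding torus_mass_def by simp
  qed
qed

lemma torus_mass_has_time_derivative:
  assumes f: "spacetime_smooth f" and t: "t \<ge> 0"
  shows "((\<lambda>t. torus_mass (f t)) has_real_derivative torus_mass (time_deriv f t)) (at t within {0..})"
  unfolding torus_mass_def
proof (rule leibniz_rule_field_derivative)
  show "((\<lambda>s. (case z of (x, y) \<Rightarrow> f s (torus_pt x y))) has_real_derivative
      (case z of (x, y) \<Rightarrow> time_deriv f s (torus_pt x y))) (at s within {0..})"
    if "s \<in> {0..}" for s z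
    using spacetime_smooth_has_time_deriv[OF f] that
    by (auto simp: has_real_derivative_iff_has_vector_derivative split: prod.split)
  show "(\<lambda>(x, y). f s (torus_pt x y)) integrable_on cbox (0, 0) (2 * pi, 2 * pi)"
    if "s \<in> {0..}" for s
    using that by (intro torus_smooth_integrable spacetime_smooth_slice f) auto
  show "continuous_on ({0..} \<times> cbox (0, 0) (2 * pi, 2 * pi))
    (\<lambda>(t, x, y). time_deriv f t (torus_pt x y))"
    by (intro spacetime_smooth_continuous spacetime_smooth_time_deriv f) auto
qed (use t in auto)

section \<open>Uniqueness by the energy method\<close>

text \<open>Multiplied by \<open>exp (- C t)\<close>, the function becomes nonincreasing.\<close>

lemma gronwall_zero:
  fixes E :: "real \<Rightarrow> real"
  assumes E': "\<And>t. t \<ge> 0 \<Longrightarrow> (E has_real_derivative E' t) (at t within {0..})"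
    and le: "\<And>t. t \<ge> 0 \<Longrightarrow> E' t \<le> C * E t"
    and "E 0 = 0" and "t \<ge> 0"
  shows "E t \<le> 0"
proof (cases "t = 0")
  case False
  let ?h = "\<lambda>s. E s * exp (- (C * s))"
  have "(?h has_derivative (\<lambda>v. (E' s - C * E s) * exp (- (C * s)) * v)) (at s within {0..t})"
    if "0 \<le> s" "s \<le> t" for s
  proof -
    have "(E has_real_derivative E' s) (at s within {0..t})"
      using E'[OF that(1)] by (rule has_field_derivative_subset) auto
    then have "(?h has_real_derivative (E' s - C * E s) * exp (- (C * s))) (at s within {0..t})"
      by (auto intro!: derivative_eq_intros simp: algebra_simps)
    then show ?thesis by (simp add: has_field_derivative_def)
  qed
  then obtain s where s: "s \<in> {0<..<t}" "?h t - ?h 0 = (E' s - C * E s) * exp (- (C * s)) * (t - 0)"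
    using mvt_simple[of 0 t ?h "\<lambda>s v. (E' s - C * E s) * exp (- (C * s)) * v"] False assms(4)
    by auto
  then have "?h t \<le> 0"
    using le[of s] assms(3) by (auto simp: mult_le_0_iff)
  then show ?thesis by (simp add: mult_le_0_iff)
qed (use assms in simp)

text \<open>Young's inequality for the only term of the energy balance that is neither a divergence
  nor a dissipation.\<close>

lemma sum_product_bound:
  fixes r C B1 B2 u1 u2 :: real
  assumes "\<bar>r\<bar> \<le> C"
  shows "2 * (r * (B1 * u2 - u1 * B2)) \<le> C * (u1 * u1 + u2 * u2 + (B1 * B1 + B2 * B2))"
proof -
  have sq: "2 * \<bar>a * b\<bar> \<le> a * a + b * b" for a b :: real
    using zero_le_power2[of "\<bar>a\<bar> - \<bar>b\<bar>"] by (simp add: power2_diff abs_mult flip: power2_eq_square)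
  have "2 * (r * (B1 * u2 - u1 * B2)) \<le> \<bar>r\<bar> * (2 * \<bar>B1 * u2 - u1 * B2\<bar>)"
    using abs_ge_self[of "r * (B1 * u2 - u1 * B2)"] by (simp add: abs_mult)
  also have "\<dots> \<le> C * (u1 * u1 + u2 * u2 + (B1 * B1 + B2 * B2))"
  proof (rule mult_mono[OF assms])
    have "2 * \<bar>B1 * u2 - u1 * B2\<bar> \<le> 2 * \<bar>B1 * u2\<bar> + 2 * \<bar>u1 * B2\<bar>"
      using abs_triangle_ineq4[of "B1 * u2" "u1 * B2"] by simp
    also have "\<dots> \<le> (B1 * B1 + u2 * u2) + (u1 * u1 + B2 * B2)"
      by (intro add_mono sq)
    finally show "2 * \<bar>B1 * u2 - u1 * B2\<bar> \<le> u1 * u1 + u2 * u2 + (B1 * B1 + B2 * B2)"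
      by simp
  qed (use assms in auto)
  finally show ?thesis .
qed

lemma laplacian_nth:
  assumes "spacetime_smooth v" "t \<ge> 0"
  shows "laplacian (v t) p $ j = laplacian (\<lambda>p. v t p $ j) p"
proof -
  have "pderiv_torus i (\<lambda>p. v t p $ j) = (\<lambda>p. pderiv_torus i (v t) p $ j)" for i
    using assms by (intro ext pderiv_torus_nth spacetime_smooth_slice)
  moreover have "pderiv_torus i (\<lambda>p. pderiv_torus i (v t) p $ j) p = pderiv_torus i (pderiv_torus i (v t)) p $ j" for i
    using assms by (intro pderiv_torus_nth spacetime_smooth_slice[OF spacetime_smooth_pderiv])
  ultimately show ?thesis by (simp add: laplacian_def)
qed

lemma MHD_solution_components:
  assumes sol: "global_smooth_MHD_solution \<nu> \<eta> u0 b0 u b"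
  obtains P :: "real \<Rightarrow> torus \<Rightarrow> real" where "spacetime_smooth P"
    "\<forall>t\<ge>0. \<forall>p j. time_deriv (\<lambda>t p. u t p $ j) t p = \<nu> * laplacian (\<lambda>p. u t p $ j) p - pderiv_torus j (P t) p
       + (\<Sum>i\<in>UNIV. b t p $ i * pderiv_torus i (\<lambda>p. b t p $ j) p - u t p $ i * pderiv_torus i (\<lambda>p. u t p $ j) p)"
    "\<forall>t\<ge>0. \<forall>p j. time_deriv (\<lambda>t p. b t p $ j) t p = \<eta> * laplacian (\<lambda>p. b t p $ j) p
       + (\<Sum>i\<in>UNIV. b t p $ i * pderiv_torus i (\<lambda>p. u t p $ j) p - u t p $ i * pderiv_torus i (\<lambda>p. b t p $ j) p)"
    "\<forall>t\<ge>0. \<forall>p. (\<Sum>i\<in>UNIV. pderiv_torus i (\<lambda>p. u t p $ i) p) = 0"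
    "\<forall>t\<ge>0. \<forall>p. (\<Sum>i\<in>UNIV. pderiv_torus i (\<lambda>p. b t p $ i) p) = 0"
proof -
  obtain P where P: "spacetime_smooth P" "\<And>t p. t \<ge> 0 \<Longrightarrow>
       time_deriv u t p + advect (u t) (u t) p + grad (P t) p = \<nu> *\<^sub>R laplacian (u t) p + advect (b t) (b t) p"
    using sol unfolding global_smooth_MHD_solution_def by blast
  have u: "spacetime_smooth u" and b: "spacetime_smooth b"
    and b_eq: "\<And>t p. t \<ge> 0 \<Longrightarrow> time_deriv b t p + advect (u t) (b t) p
                  = advect (b t) (u t) p + \<eta> *\<^sub>R laplacian (b t) p"
    and div: "\<And>t p. t \<ge> 0 \<Longrightarrow> divergence (u t) p = 0" "\<And>t p. t \<ge> 0 \<Longrightarrow> divergence (b t) p = 0"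
    using sol unfolding global_smooth_MHD_solution_def by blast+
  have nth: "pderiv_torus i (u t) p $ j = pderiv_torus i (\<lambda>p. u t p $ j) p"
    "pderiv_torus i (b t) p $ j = pderiv_torus i (\<lambda>p. b t p $ j) p" if "t \<ge> 0" for i j t p
    using that u b by (simp_all add: pderiv_torus_nth spacetime_smooth_slice)
  have time_nth: "time_deriv w t p $ j = time_deriv (\<lambda>t p. w t p $ j) t p"
    if "spacetime_smooth w" "t \<ge> 0" for w :: "real \<Rightarrow> torus \<Rightarrow> real ^ 2" and j t p
    using that bounded_linear.has_vector_derivative[OF bounded_linear_vec_nth
      spacetime_smooth_has_time_deriv[OF that]]
    by (intro time_deriv_eqI[symmetric])
  let ?u = "\<lambda>t p j. time_deriv (\<lambda>t p. u t p $ j) t p = \<nu> * laplacian (\<lambda>p. u t p $ j) p - pderiv_torus j (P t) p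
       + (\<Sum>i\<in>UNIV. b t p $ i * pderiv_torus i (\<lambda>p. b t p $ j) p - u t p $ i * pderiv_torus i (\<lambda>p. u t p $ j) p)"
  let ?b = "\<lambda>t p j. time_deriv (\<lambda>t p. b t p $ j) t p = \<eta> * laplacian (\<lambda>p. b t p $ j) p
       + (\<Sum>i\<in>UNIV. b t p $ i * pderiv_torus i (\<lambda>p. u t p $ j) p - u t p $ i * pderiv_torus i (\<lambda>p. b t p $ j) p)"
  let ?div = "\<lambda>w::real \<Rightarrow> torus \<Rightarrow> real ^ 2. \<lambda>t p. (\<Sum>i\<in>UNIV. pderiv_torus i (\<lambda>p. w t p $ i) p) = 0"
  have "?u t p j \<and> ?b t p j \<and> ?div u t p \<and> ?div b t p" if t: "t \<ge> 0" for t p j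
  proof (intro conjI)
    note simps = time_nth[OF u t] time_nth[OF b t] nth[OF t] laplacian_nth[OF u t] laplacian_nth[OF b t]
    have "(time_deriv u t p + advect (u t) (u t) p + grad (P t) p) $ j
        = (\<nu> *\<^sub>R laplacian (u t) p + advect (b t) (b t) p) $ j"
      by (simp only: P(2)[OF t])
    then show "?u t p j"
      by (simp add: grad_def advect_def simps sum_subtractf)
    have "(time_deriv b t p + advect (u t) (b t) p) $ j
        = (advect (b t) (u t) p + \<eta> *\<^sub>R laplacian (b t) p) $ j"
      by (simp only: b_eq[OF t])
    then show "?b t p j"
      by (simp add: advect_def simps sum_subtractf)
    show "?div u t p" "?div b t p"
      using div[OF t] by (simp_all add: divergence_def nth[OF t])
  qed
  then show thesis using that[of P] P(1) by blast
qed

text \<open>Energy method.  With \<open>B = b - (0, g)\<close>, the quantity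
  \<open>e = |u|\<^sup>2 + |B|\<^sup>2\<close> satisfies a balance law whose flux in direction \<open>i\<close> is the function \<open>flux i\<close>
  below, applied to the \<open>i\<close>-th components of \<open>u\<close> and of the full field \<open>b\<close>.
  The coupling terms \<open>u \<cdot> (b \<cdot> \<nabla>) B\<close> and \<open>B \<cdot> (b \<cdot> \<nabla>) u\<close> combine to the divergence of \<open>(u \<cdot> B) b\<close>,
  so the only source left comes from the gradient of the shear.\<close>

lemma shear_solution_unique:
  fixes g :: "real \<Rightarrow> torus \<Rightarrow> real"
  assumes sol: "global_smooth_MHD_solution \<nu> \<eta> (\<lambda>p. 0) (\<lambda>p. axis 2 (g 0 p)) u b"
    and coeff: "\<nu> \<ge> 0" "\<eta> \<ge> 0"
    and g: "spacetime_smooth g"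
    and shear: "\<And>t p. t \<ge> 0 \<Longrightarrow> pderiv_torus 2 (g t) p = 0"
    and heat: "\<And>t p. t \<ge> 0 \<Longrightarrow> time_deriv g t p = \<eta> * laplacian (g t) p"
    and bound: "\<And>t p. t \<ge> 0 \<Longrightarrow> \<bar>pderiv_torus 1 (g t) p\<bar> \<le> C"
    and t0: "t0 \<ge> 0"
  shows "u t0 = (\<lambda>p. 0)" and "b t0 = (\<lambda>p. axis 2 (g t0 p))"
proof -
  define u1 u2 B1 where "u1 t p = u t p $ 1" and "u2 t p = u t p $ 2" and "B1 t p = b t p $ 1" for t p
  define b2 where "b2 t p = b t p $ 2" for t p
  define B2 where "B2 t p = b2 t p - g t p" for t p
  obtain P where P: "spacetime_smooth P"
    and eqs: "\<forall>t\<ge>0. \<forall>p j. time_deriv (\<lambda>t p. u t p $ j) t p = \<nu> * laplacian (\<lambda>p. u t p $ j) p - pderiv_torus j (P t) p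
       + (\<Sum>i\<in>UNIV. b t p $ i * pderiv_torus i (\<lambda>p. b t p $ j) p - u t p $ i * pderiv_torus i (\<lambda>p. u t p $ j) p)"
    "\<forall>t\<ge>0. \<forall>p j. time_deriv (\<lambda>t p. b t p $ j) t p = \<eta> * laplacian (\<lambda>p. b t p $ j) p
       + (\<Sum>i\<in>UNIV. b t p $ i * pderiv_torus i (\<lambda>p. u t p $ j) p - u t p $ i * pderiv_torus i (\<lambda>p. b t p $ j) p)"
    "\<forall>t\<ge>0. \<forall>p. (\<Sum>i\<in>UNIV. pderiv_torus i (\<lambda>p. u t p $ i) p) = 0"
    "\<forall>t\<ge>0. \<forall>p. (\<Sum>i\<in>UNIV. pderiv_torus i (\<lambda>p. b t p $ i) p) = 0"
    by (rule MHD_solution_components[OF sol])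
  have init: "u 0 = (\<lambda>p. 0)" "b 0 = (\<lambda>p. axis 2 (g 0 p))"
    and ub: "spacetime_smooth u" "spacetime_smooth b"
    using sol unfolding global_smooth_MHD_solution_def by auto
  have sm: "spacetime_smooth u1" "spacetime_smooth u2" "spacetime_smooth B1" "spacetime_smooth b2"
    unfolding u1_def u2_def B1_def b2_def using ub by (simp_all add: spacetime_smooth_nth)
  have smB2: "spacetime_smooth B2"
    unfolding B2_def using sm g by (simp add: spacetime_smooth_diff)
  note sm = sm(1-3) smB2 g P
  note tsm = sm[THEN spacetime_smooth_slice]
  have b2: "b2 t = (\<lambda>p. B2 t p + g t p)" for t by (auto simp: B2_def)
  have Db2: "pderiv_torus i (b2 t) = (\<lambda>p. pderiv_torus i (B2 t) p + pderiv_torus i (g t) p)"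
    if "t \<ge> 0" for i t
    unfolding b2 by (rule ext) (simp add: pderiv_torus_add tsm torus_smooth_pderiv that)
  have tb2: "time_deriv b2 t p = time_deriv B2 t p + time_deriv g t p" if "t \<ge> 0" for t p
    using has_vector_derivative_add[OF spacetime_smooth_has_time_deriv[OF smB2 that]
      spacetime_smooth_has_time_deriv[OF g that]] that
    by (intro time_deriv_eqI) (simp_all add: b2)
  define e where "e t p = u1 t p * u1 t p + u2 t p * u2 t p + (B1 t p * B1 t p + B2 t p * B2 t p)" for t p
  have e: "spacetime_smooth e"
    unfolding e_def by (intro spacetime_smooth_add spacetime_smooth_mult sm)

  have mass: "torus_mass (time_deriv e t) \<le> C * torus_mass (e t)" if t: "t \<ge> 0" for t
  proof -
    note tsm = tsm[OF t]
    note smooths = torus_smooth_add torus_smooth_mult torus_smooth_const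
    note pderivs = pderiv_torus_add pderiv_torus_mult pderiv_torus_const
    have fold: "(\<lambda>t p. u t p $ 1) = u1" "(\<lambda>t p. u t p $ 2) = u2" "(\<lambda>t p. b t p $ 1) = B1" "(\<lambda>t p. b t p $ 2) = b2"
      "(\<lambda>p. u t p $ 1) = u1 t" "(\<lambda>p. u t p $ 2) = u2 t" "(\<lambda>p. b t p $ 1) = B1 t" "(\<lambda>p. b t p $ 2) = b2 t"
      "\<And>p. u t p $ 1 = u1 t p" "\<And>p. u t p $ 2 = u2 t p" "\<And>p. b t p $ 1 = B1 t p" "\<And>p. b t p $ 2 = b2 t p"
      by (simp_all add: fun_eq_iff u1_def u2_def B1_def b2_def)
    define flux where "flux i w c p = (-1) * (w p * e t p) + (-2) * (w p * P t p)
        + 2 * \<nu> * (u1 t p * pderiv_torus i (u1 t) p + u2 t p * pderiv_torus i (u2 t) p)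
        + 2 * (c p * (u1 t p * B1 t p + u2 t p * B2 t p))
        + 2 * \<eta> * (B1 t p * pderiv_torus i (B1 t) p + B2 t p * pderiv_torus i (B2 t) p)" for i w c p
    have flux_smooth: "torus_smooth (flux i w c)" if "torus_smooth w" "torus_smooth c" for i w c
      unfolding flux_def[abs_def] e_def by (intro smooths tsm torus_smooth_pderiv that)
    have Dflux: "pderiv_torus i (flux i w c) p =
         - (pderiv_torus i w p * e t p) - 2 * (w p * (u1 t p * pderiv_torus i (u1 t) p
            + u2 t p * pderiv_torus i (u2 t) p + B1 t p * pderiv_torus i (B1 t) p + B2 t p * pderiv_torus i (B2 t) p))
         - 2 * (pderiv_torus i w p * P t p + w p * pderiv_torus i (P t) p)
         + 2 * \<nu> * ((pderiv_torus i (u1 t) p)\<^sup>2 + (pderiv_torus i (u2 t) p)\<^sup>2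
             + u1 t p * pderiv_torus i (pderiv_torus i (u1 t)) p + u2 t p * pderiv_torus i (pderiv_torus i (u2 t)) p)
         + 2 * (pderiv_torus i c p * (u1 t p * B1 t p + u2 t p * B2 t p)
             + c p * (pderiv_torus i (u1 t) p * B1 t p + u1 t p * pderiv_torus i (B1 t) p
                 + pderiv_torus i (u2 t) p * B2 t p + u2 t p * pderiv_torus i (B2 t) p))
         + 2 * \<eta> * ((pderiv_torus i (B1 t) p)\<^sup>2 + (pderiv_torus i (B2 t) p)\<^sup>2
             + B1 t p * pderiv_torus i (pderiv_torus i (B1 t)) p + B2 t p * pderiv_torus i (pderiv_torus i (B2 t)) p)"
      if wc: "torus_smooth w" "torus_smooth c" for i w c p
      unfolding flux_def e_def
      by (simp only: pderivs smooths tsm torus_smooth_pderiv wc) (simp add: algebra_simps power2_eq_square)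
    have b2_smooth: "torus_smooth (b2 t)" unfolding b2 by (intro smooths tsm)
    \<comment> \<open>All second derivatives and all products with the pressure are absorbed by the flux.\<close>
    have balance: "time_deriv e t p = pderiv_torus 1 (flux 1 (u1 t) (B1 t)) p + pderiv_torus 2 (flux 2 (u2 t) (b2 t)) p
        - 2 * \<nu> * ((pderiv_torus 1 (u1 t) p)\<^sup>2 + (pderiv_torus 1 (u2 t) p)\<^sup>2 + (pderiv_torus 2 (u1 t) p)\<^sup>2 + (pderiv_torus 2 (u2 t) p)\<^sup>2)
        - 2 * \<eta> * ((pderiv_torus 1 (B1 t) p)\<^sup>2 + (pderiv_torus 1 (B2 t) p)\<^sup>2 + (pderiv_torus 2 (B1 t) p)\<^sup>2 + (pderiv_torus 2 (B2 t) p)\<^sup>2)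
        + 2 * (pderiv_torus 1 (g t) p * (B1 t p * u2 t p - u1 t p * B2 t p))" for p
    proof -
      have te: "time_deriv e t p = 2 * (u1 t p * time_deriv u1 t p + u2 t p * time_deriv u2 t p
         + B1 t p * time_deriv B1 t p + B2 t p * time_deriv B2 t p)"
        using spacetime_smooth_has_time_deriv[OF sm(1) t, of p] spacetime_smooth_has_time_deriv[OF sm(2) t, of p]
          spacetime_smooth_has_time_deriv[OF sm(3) t, of p] spacetime_smooth_has_time_deriv[OF sm(4) t, of p]
        unfolding e_def
        by (intro time_deriv_eqI t)
          (auto simp flip: has_real_derivative_iff_has_vector_derivative intro!: derivative_eq_intros)
      have dd: "pderiv_torus i (\<lambda>p. pderiv_torus i (B2 t) p + pderiv_torus i (g t) p) p
         = pderiv_torus i (pderiv_torus i (B2 t)) p + pderiv_torus i (pderiv_torus i (g t)) p" for i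
        by (simp add: pderivs tsm torus_smooth_pderiv)
      have b2p: "b2 t p = B2 t p + g t p" by (simp add: b2)
      have u1_eq: "time_deriv u1 t p = \<nu> * (pderiv_torus 1 (pderiv_torus 1 (u1 t)) p + pderiv_torus 2 (pderiv_torus 2 (u1 t)) p)
          - pderiv_torus 1 (P t) p + (B1 t p * pderiv_torus 1 (B1 t) p - u1 t p * pderiv_torus 1 (u1 t) p)
          + ((B2 t p + g t p) * pderiv_torus 2 (B1 t) p - u2 t p * pderiv_torus 2 (u1 t) p)"
        using eqs(1)[rule_format, OF t, of 1 p] unfolding fold laplacian_def sum_2 by (simp add: b2)
      have u2_eq: "time_deriv u2 t p = \<nu> * (pderiv_torus 1 (pderiv_torus 1 (u2 t)) p + pderiv_torus 2 (pderiv_torus 2 (u2 t)) p)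
          - pderiv_torus 2 (P t) p + (B1 t p * (pderiv_torus 1 (B2 t) p + pderiv_torus 1 (g t) p) - u1 t p * pderiv_torus 1 (u2 t) p)
          + ((B2 t p + g t p) * pderiv_torus 2 (B2 t) p - u2 t p * pderiv_torus 2 (u2 t) p)"
        using eqs(1)[rule_format, OF t, of 2 p] shear[OF t, of p] unfolding fold laplacian_def sum_2 Db2[OF t] by (simp add: b2)
      have B1_eq: "time_deriv B1 t p = \<eta> * (pderiv_torus 1 (pderiv_torus 1 (B1 t)) p + pderiv_torus 2 (pderiv_torus 2 (B1 t)) p)
          + (B1 t p * pderiv_torus 1 (u1 t) p - u1 t p * pderiv_torus 1 (B1 t) p)
          + ((B2 t p + g t p) * pderiv_torus 2 (u1 t) p - u2 t p * pderiv_torus 2 (B1 t) p)"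
        using eqs(2)[rule_format, OF t, of 1 p] unfolding fold laplacian_def sum_2 by (simp add: b2)
      have B2_eq: "time_deriv B2 t p = \<eta> * (pderiv_torus 1 (pderiv_torus 1 (B2 t)) p + pderiv_torus 2 (pderiv_torus 2 (B2 t)) p)
          + (B1 t p * pderiv_torus 1 (u2 t) p - u1 t p * (pderiv_torus 1 (B2 t) p + pderiv_torus 1 (g t) p))
          + ((B2 t p + g t p) * pderiv_torus 2 (u2 t) p - u2 t p * pderiv_torus 2 (B2 t) p)"
        using eqs(2)[rule_format, OF t, of 2 p] shear[OF t, of p] heat[OF t, of p] tb2[OF t, of p]
        unfolding fold laplacian_def sum_2 Db2[OF t] dd by (simp add: b2 algebra_simps)
      have div_u: "pderiv_torus 2 (u2 t) p = - pderiv_torus 1 (u1 t) p"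
        using eqs(3)[rule_format, OF t, of p] unfolding fold sum_2 by simp
      have div_B: "pderiv_torus 2 (B2 t) p = - pderiv_torus 1 (B1 t) p"
        using eqs(4)[rule_format, OF t, of p] shear[OF t, of p] unfolding fold sum_2 Db2[OF t] by simp
      have div_b: "pderiv_torus 2 (b2 t) p = - pderiv_torus 1 (B1 t) p"
        using div_B shear[OF t, of p] Db2[OF t] by simp
      show ?thesis
        unfolding te u1_eq u2_eq B1_eq B2_eq Dflux[OF tsm(1,3)] Dflux[OF tsm(2) b2_smooth]
          div_u div_B div_b e_def
        by (simp add: b2p algebra_simps power2_eq_square)
    qed
    have "torus_mass (time_deriv e t) \<le> torus_mass (\<lambda>p. (pderiv_torus 1 (flux 1 (u1 t) (B1 t)) p
        + pderiv_torus 2 (flux 2 (u2 t) (b2 t)) p) + C * e t p)"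
    proof (rule torus_mass_mono)
      fix p
      have "2 * (pderiv_torus 1 (g t) p * (B1 t p * u2 t p - u1 t p * B2 t p)) \<le> C * e t p"
        unfolding e_def by (rule sum_product_bound[OF bound[OF t]])
      then show "time_deriv e t p \<le> (pderiv_torus 1 (flux 1 (u1 t) (B1 t)) p
        + pderiv_torus 2 (flux 2 (u2 t) (b2 t)) p) + C * e t p"
        using coeff unfolding balance by (simp add: add_increasing2 diff_le_eq)
    qed (intro smooths torus_smooth_pderiv flux_smooth tsm b2_smooth
        spacetime_smooth_slice[OF e t] spacetime_smooth_slice[OF spacetime_smooth_time_deriv[OF e] t])+
    also have "\<dots> = torus_mass (\<lambda>p. pderiv_torus 1 (flux 1 (u1 t) (B1 t)) p)
        + torus_mass (\<lambda>p. pderiv_torus 2 (flux 2 (u2 t) (b2 t)) p) + C * torus_mass (e t)"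
      using tsm b2_smooth spacetime_smooth_slice[OF e t]
      by (simp add: torus_mass_add torus_mass_cmult flux_smooth smooths torus_smooth_pderiv)
    also have "\<dots> = C * torus_mass (e t)"
      by (simp add: torus_mass_pderiv flux_smooth tsm b2_smooth)
    finally show ?thesis .
  qed
  have "torus_mass (e t) \<le> 0" if "t \<ge> 0" for t
  proof (rule gronwall_zero[OF torus_mass_has_time_derivative[OF e] mass _ that])
    show "torus_mass (e 0) = 0"
      by (simp add: torus_mass_def e_def u1_def u2_def B1_def B2_def b2_def init axis_def case_prod_unfold)
  qed
  moreover have e_nonneg: "e t p \<ge> 0" for t p by (simp add: e_def)
  have "torus_mass (e t0) \<ge> torus_mass (\<lambda>p. 0)"
    using spacetime_smooth_slice[OF e t0] e_nonneg by (intro torus_mass_mono torus_smooth_const)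
  moreover have "torus_mass (\<lambda>p. 0) = 0" by (simp add: torus_mass_def case_prod_unfold)
  ultimately have "torus_mass (e t0) = 0"
    using t0 by (intro order_antisym) simp_all
  then have "e t0 p = 0" for p
    using torus_mass_eq_0_imp[OF spacetime_smooth_slice[OF e t0]] e_nonneg by blast
  then have "u1 t0 p = 0 \<and> u2 t0 p = 0 \<and> B1 t0 p = 0 \<and> B2 t0 p = 0" for p
    unfolding e_def by (simp add: add_nonneg_eq_0_iff)
  then show "u t0 = (\<lambda>p. 0)" "b t0 = (\<lambda>p. axis 2 (g t0 p))"
    by (simp_all add: fun_eq_iff vec_eq_iff forall_2 u1_def u2_def B1_def B2_def b2_def axis_def)
qed

section \<open>Trigonometric functions of the coordinates\<close>

text \<open>The value is an arbitrary choice modulo \<open>2 * pi\<close>; its sine and cosine are well-defined smooth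
  functions on the torus.\<close>

definition coord :: "2 \<Rightarrow> torus \<Rightarrow> real" where
  "coord i p = torus_rep p $ i"

lemma coord_torus_of: "\<exists>k::int. coord i (torus_of x) = x $ i + 2 * pi * k"
proof -
  have "torus_rel (torus_rep (torus_of x)) x"
    by (simp add: Quotient_abs_rep[OF Quotient_torus] flip: torus_of_eq_iff)
  then obtain k :: int where "torus_rep (torus_of x) $ i - x $ i = 2 * pi * k"
    unfolding torus_rel_def by blast
  then show ?thesis unfolding coord_def by (intro exI[of _ k]) simp
qed

lemma sin_cos_coord_torus_of:
  "sin (coord i (torus_of x)) = sin (x $ i)" "cos (coord i (torus_of x)) = cos (x $ i)"
  using coord_torus_of[of i x] sin_cos_eq_iff[of "coord i (torus_of x)" "x $ i"] by auto

lemma sin_cos_coord_torus_pt: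
  "sin (coord 1 (torus_pt x y)) = sin x" "cos (coord 1 (torus_pt x y)) = cos x"
  "sin (coord 2 (torus_pt x y)) = sin y" "cos (coord 2 (torus_pt x y)) = cos y"
  by (simp_all add: torus_pt_def sin_cos_coord_torus_of)

lemma torus_eqI:
  assumes "\<And>i. sin (coord i p) = sin (coord i q)" "\<And>i. cos (coord i p) = cos (coord i q)"
  shows "p = q"
proof -
  have "torus_rel (torus_rep p) (torus_rep q)"
    unfolding torus_rel_def
  proof
    fix i
    obtain k :: int where "coord i p = coord i q + 2 * pi * k"
      using sin_cos_eq_iff[of "coord i p" "coord i q"] assms by auto
    then show "\<exists>k::int. torus_rep p $ i - torus_rep q $ i = 2 * pi * k"
      by (auto simp: coord_def)
  qed
  then show ?thesis by (simp add: Quotient_rel_rep[OF Quotient_torus])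
qed

lemma torus_smooth_sin_cos_coord:
  "torus_smooth (\<lambda>p. sin (coord i p))" "torus_smooth (\<lambda>p. cos (coord i p))"
  unfolding torus_smooth_def smooth_on_def sin_cos_coord_torus_of
  using Ck_on_compose_affine[OF bounded_linear_vec_nth[of i], of UNIV 0 UNIV] Ck_on_sin_cos[of _ UNIV]
  by auto

lemma spacetime_smooth_of_torus_smooth:
  assumes "torus_smooth f"
  shows "spacetime_smooth (\<lambda>t. f)"
  using assms Ck_on_compose_affine[OF bounded_linear_snd, of spacetime 0 UNIV _ "\<lambda>x. f (torus_of x)"]
  unfolding torus_smooth_def spacetime_smooth_def smooth_on_def case_prod_unfold by auto

lemma spacetime_smooth_exp: "spacetime_smooth (\<lambda>t p. exp (c * t))"
  using Ck_on_compose_affine[of "\<lambda>z::real \<times> (real ^ 2). c * fst z" spacetime 0 UNIV _ exp] Ck_on_exp[of _ UNIV]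
  unfolding spacetime_smooth_def smooth_on_def case_prod_unfold
  by (auto simp: bounded_linear_const_mult bounded_linear_fst)

lemma pderiv_torus_sin_cos_coord:
  "pderiv_torus i (\<lambda>p. sin (coord j p)) p = (if i = j then cos (coord j p) else 0)"
  "pderiv_torus i (\<lambda>p. cos (coord j p)) p = (if i = j then - sin (coord j p) else 0)"
proof -
  obtain x where p: "p = torus_of x" using torus_of_surj by blast
  have "((\<lambda>x. sin (coord j (torus_of x))) has_derivative (\<lambda>v. v $ j * cos (x $ j))) (at x)"
    "((\<lambda>x. cos (coord j (torus_of x))) has_derivative (\<lambda>v. - (v $ j) * sin (x $ j))) (at x)"
    unfolding sin_cos_coord_torus_of
    by (auto intro!: derivative_eq_intros bounded_linear.has_derivative[OF bounded_linear_vec_nth])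
  from this[THEN torus_derivative_along_axis]
  show "pderiv_torus i (\<lambda>p. sin (coord j p)) p = (if i = j then cos (coord j p) else 0)"
  "pderiv_torus i (\<lambda>p. cos (coord j p)) p = (if i = j then - sin (coord j p) else 0)"
    unfolding p by (auto simp: axis_def sin_cos_coord_torus_of)
qed

section \<open>Shear fields\<close>

lemma bounded_linear_axis: "bounded_linear (axis i :: real \<Rightarrow> real ^ 'n::finite)"
proof -
  have "axis i = (\<lambda>x. x *\<^sub>R (axis i 1 :: real ^ 'n))" by (auto simp: fun_eq_iff vec_eq_iff axis_def)
  then show ?thesis by (metis bounded_linear_scaleR_left)
qed

lemma pderiv_torus_axis:
  fixes f :: "torus \<Rightarrow> real"
  shows "torus_smooth f \<Longrightarrow> pderiv_torus i (\<lambda>p. axis j (f p)) p = axis j (pderiv_torus i f p)"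
  unfolding pderiv_torus_def[of i "\<lambda>p. axis j (f p)"]
  by (intro vector_derivative_at bounded_linear.has_vector_derivative[OF bounded_linear_axis]
      torus_smooth_has_pderiv)

text \<open>The shear exerts no force, because it is constant along its own direction: the momentum equation
  holds for the fluid at rest, and the induction equation is the heat equation for the profile.\<close>

lemma shear_is_solution:
  assumes g: "spacetime_smooth g"
    and shear: "\<And>t p. t \<ge> 0 \<Longrightarrow> pderiv_torus 2 (g t) p = 0"
    and heat: "\<And>t p. t \<ge> 0 \<Longrightarrow> time_deriv g t p = \<eta> * laplacian (g t) p"
  shows "global_smooth_MHD_solution \<nu> \<eta> (\<lambda>p. 0) (\<lambda>p. axis 2 (g 0 p)) (\<lambda>t p. 0) (\<lambda>t p. axis 2 (g t p))"
proof -
  have axis0: "axis j 0 = (0 :: real ^ 2)" for j by (simp add: vec_eq_iff axis_def)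
  have axis_nth: "axis 2 x $ (1::2) = 0" "axis 2 x $ (2::2) = x" for x :: real
    by (simp_all add: axis_def)
  have const: "pderiv_torus i (\<lambda>p. 0 :: real ^ 2) = (\<lambda>p. 0)" for i
    by (simp add: fun_eq_iff pderiv_torus_const)
  have time_zero: "time_deriv (\<lambda>t p. 0 :: real ^ 2) t p = 0" if "t \<ge> 0" for t p
    using that by (intro time_deriv_eqI has_vector_derivative_const)
  have zero: "laplacian (\<lambda>p. 0 :: real ^ 2) p = 0"
    "grad (\<lambda>p. 0) p = 0" "advect v (\<lambda>p. 0 :: real ^ 2) p = 0" "advect (\<lambda>p. 0) w p = 0"
    "divergence (\<lambda>p. 0) p = 0"
    for p v and w :: "torus \<Rightarrow> real ^ 2"
    by (simp_all add: laplacian_def grad_def advect_def divergence_def pderiv_torus_const const vec_eq_iff)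
  have pd: "pderiv_torus i (\<lambda>p. axis 2 (g t p) :: real ^ 2) = (\<lambda>p. axis 2 (pderiv_torus i (g t) p))" if "t \<ge> 0" for i t
    using that by (intro ext pderiv_torus_axis spacetime_smooth_slice g)
  have self_advect: "advect (\<lambda>p. axis 2 (g t p)) (\<lambda>p. axis 2 (g t p) :: real ^ 2) p = 0"
    and div: "divergence (\<lambda>p. axis 2 (g t p)) p = 0" if "t \<ge> 0" for t p
    using shear[OF that] by (simp_all add: advect_def divergence_def pd[OF that] sum_2 axis0 axis_nth)
  have lap: "laplacian (\<lambda>p. axis 2 (g t p) :: real ^ 2) p = axis 2 (laplacian (g t) p)" if "t \<ge> 0" for t p
    using that
    by (simp add: laplacian_def pd pderiv_torus_axis torus_smooth_pderiv spacetime_smooth_slice g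
        vec_eq_iff forall_2 sum_2 axis_nth)
  have "time_deriv (\<lambda>t p. axis 2 (g t p) :: real ^ 2) t p = \<eta> *\<^sub>R axis 2 (laplacian (g t) p)" if "t \<ge> 0" for t p
  proof -
    have "time_deriv (\<lambda>t p. axis 2 (g t p) :: real ^ 2) t p = axis 2 (time_deriv g t p)"
      using that by (intro time_deriv_eqI bounded_linear.has_vector_derivative[OF bounded_linear_axis]
        spacetime_smooth_has_time_deriv g)
    then show ?thesis by (simp add: heat[OF that] vec_eq_iff axis_def)
  qed
  moreover have "spacetime_smooth (\<lambda>t p. axis 2 (g t p) :: real ^ 2)"
    by (rule spacetime_smooth_bounded_linear[OF bounded_linear_axis g])
  ultimately show ?thesis
    unfolding global_smooth_MHD_solution_def
    by (auto simp: zero time_zero axis0 self_advect div lap intro!: spacetime_smooth_const exI[of _ "\<lambda>t p. 0"])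
qed

section \<open>Integral lines of shear fields\<close>

text \<open>The lift in \<open>has_velocity\<close> need be differentiable at one time only and may change from time to time.  The
  functions \<open>sin\<close> and \<open>cos\<close> of the coordinates are independent of the lift, which turns statements on
  curves in the torus into statements on real functions.\<close>

lemma has_velocity_sin_cos_coord:
  assumes "has_velocity \<gamma> v s"
  shows "((\<lambda>r. sin (coord i (\<gamma> r))) has_real_derivative cos (coord i (\<gamma> s)) * v $ i) (at s)"
    and "((\<lambda>r. cos (coord i (\<gamma> r))) has_real_derivative - sin (coord i (\<gamma> s)) * v $ i) (at s)"
proof -
  obtain c where c: "(c has_vector_derivative v) (at s)" and \<gamma>: "\<forall>\<^sub>F r in nhds s. \<gamma> r = torus_of (c r)"
    using assms unfolding has_velocity_def by blast
  have ci: "((\<lambda>r. c r $ i) has_real_derivative v $ i) (at s)"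
    using bounded_linear.has_vector_derivative[OF bounded_linear_vec_nth c]
    by (simp add: has_real_derivative_iff_has_vector_derivative)
  have \<gamma>s: "\<gamma> s = torus_of (c s)" using \<gamma> by (rule eventually_nhds_x_imp_x)
  have ev: "\<forall>\<^sub>F r in nhds s. sin (coord i (\<gamma> r)) = sin (c r $ i)" "\<forall>\<^sub>F r in nhds s. cos (coord i (\<gamma> r)) = cos (c r $ i)"
    using \<gamma> by (auto elim!: eventually_mono simp: sin_cos_coord_torus_of)
  have "((\<lambda>r. sin (c r $ i)) has_real_derivative cos (coord i (\<gamma> s)) * v $ i) (at s)"
    "((\<lambda>r. cos (c r $ i)) has_real_derivative - sin (coord i (\<gamma> s)) * v $ i) (at s)"
    unfolding \<gamma>s sin_cos_coord_torus_of by (auto intro!: derivative_eq_intros ci)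
  then show "((\<lambda>r. sin (coord i (\<gamma> r))) has_real_derivative cos (coord i (\<gamma> s)) * v $ i) (at s)"
    "((\<lambda>r. cos (coord i (\<gamma> r))) has_real_derivative - sin (coord i (\<gamma> s)) * v $ i) (at s)"
    using DERIV_cong_ev[OF refl ev(1) refl] DERIV_cong_ev[OF refl ev(2) refl] by blast+
qed

lemma integral_curve_coord_constant:
  assumes \<gamma>: "integral_curve X J \<gamma>" and X: "\<And>s. s \<in> J \<Longrightarrow> X (\<gamma> s) $ i = 0"
    and "s \<in> J" "r \<in> J"
  shows "sin (coord i (\<gamma> r)) = sin (coord i (\<gamma> s))" "cos (coord i (\<gamma> r)) = cos (coord i (\<gamma> s))"
proof -
  have J: "convex J" using \<gamma> unfolding integral_curve_def by (simp add: is_interval_convex)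
  have d: "((\<lambda>r. sin (coord i (\<gamma> r))) has_real_derivative 0) (at s within J)"
    "((\<lambda>r. cos (coord i (\<gamma> r))) has_real_derivative 0) (at s within J)" if "s \<in> J" for s
    using has_velocity_sin_cos_coord[of \<gamma> "X (\<gamma> s)" s i] X[OF that] \<gamma> that
    unfolding integral_curve_def by (auto intro: has_field_derivative_at_within)
  show "sin (coord i (\<gamma> r)) = sin (coord i (\<gamma> s))" "cos (coord i (\<gamma> r)) = cos (coord i (\<gamma> s))"
    using has_field_derivative_zero_constant[OF J d(1)] has_field_derivative_zero_constant[OF J d(2)]
      assms(3,4) by metis+
qed

text \<open>A profile is a function of the first coordinate on the circle, hence of its sine and cosine.\<close>

locale shear_profile =
  fixes G :: "torus \<Rightarrow> real" and H :: "real \<Rightarrow> real \<Rightarrow> real"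
  assumes factors: "G p = H (sin (coord 1 p)) (cos (coord 1 p))"
begin

text \<open>The field is constant along the straight line in its own direction, which is therefore an
  integral curve; being defined for all times it is maximal.\<close>

lemma line_through: "\<exists>L\<in>integral_lines (\<lambda>p. axis 2 (G p)). p \<in> L"
proof -
  let ?X = "\<lambda>p. axis 2 (G p) :: real ^ 2"
  define \<gamma> where "\<gamma> s = torus_shift p (s *\<^sub>R ?X p)" for s
  define c where "c s = torus_rep p + s *\<^sub>R ?X p" for s
  have \<gamma>: "\<gamma> s = torus_of (c s)" for s
    unfolding \<gamma>_def c_def torus_shift.abs_eq[symmetric] by (simp add: Quotient_abs_rep[OF Quotient_torus])
  have "?X (\<gamma> s) = ?X p" for s
    unfolding factors \<gamma> sin_cos_coord_torus_of by (simp add: c_def coord_def axis_def)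
  moreover have "(c has_vector_derivative ?X p) (at s)" for s
    unfolding c_def has_vector_derivative_def by (auto intro!: derivative_eq_intros)
  ultimately have "has_velocity \<gamma> (?X (\<gamma> s)) s" for s
    unfolding has_velocity_def by (intro exI[of _ c]) (simp add: \<gamma>)
  then have "integral_curve ?X UNIV \<gamma>"
    unfolding integral_curve_def by simp
  then have "maximal_integral_curve ?X UNIV \<gamma>"
    unfolding maximal_integral_curve_def by auto
  moreover have "\<gamma> 0 = p" by (simp add: \<gamma>_def torus_shift_0)
  ultimately show ?thesis unfolding integral_lines_def by blast
qed

text \<open>Along a line the first coordinate is constant, so the profile is constant as well.
  If it vanishes, the second coordinate is constant too and the line is a point; conversely, a
  constant curve has velocity zero.\<close>

lemma line_singleton_iff:
  assumes "L \<in> integral_lines (\<lambda>p. axis 2 (G p))" "p \<in> L"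
  shows "L = {p} \<longleftrightarrow> G p = 0"
proof -
  let ?X = "\<lambda>p. axis 2 (G p) :: real ^ 2"
  obtain J \<gamma> where \<gamma>: "integral_curve ?X J \<gamma>" and L: "L = \<gamma> ` J"
    using assms(1) unfolding integral_lines_def maximal_integral_curve_def by blast
  obtain s where s: "s \<in> J" "\<gamma> s = p" using assms(2) L by auto
  have c1: "sin (coord 1 (\<gamma> r)) = sin (coord 1 p)" "cos (coord 1 (\<gamma> r)) = cos (coord 1 p)" if "r \<in> J" for r
    using integral_curve_coord_constant[OF \<gamma> _ s(1) that, of 1] s by (auto simp: axis_def)
  show ?thesis
  proof
    assume "G p = 0"
    then have "G (\<gamma> r) = 0" if "r \<in> J" for r
      using c1[OF that] by (simp add: factors)
    then have c2: "sin (coord 2 (\<gamma> r)) = sin (coord 2 p)" "cos (coord 2 (\<gamma> r)) = cos (coord 2 p)" if "r \<in> J" for r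
      using integral_curve_coord_constant[OF \<gamma> _ s(1) that, of 2] s by (auto simp: axis_def)
    have "\<gamma> r = p" if "r \<in> J" for r
    proof (rule torus_eqI)
      fix i :: 2
      show "sin (coord i (\<gamma> r)) = sin (coord i p)" "cos (coord i (\<gamma> r)) = cos (coord i p)"
        using c1[OF that] c2[OF that] exhaust_2[of i] by auto
    qed
    then show "L = {p}" using L s by auto
  next
    assume "L = {p}"
    then have const: "\<gamma> r = p" if "r \<in> J" for r using that L by auto
    have J: "open J" and v: "has_velocity \<gamma> (?X p) s"
      using \<gamma> s unfolding integral_curve_def by auto
    have d: "((\<lambda>r. sin (coord 2 (\<gamma> r))) has_real_derivative 0) (at s)"
      "((\<lambda>r. cos (coord 2 (\<gamma> r))) has_real_derivative 0) (at s)"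
      by (rule has_field_derivative_transform_within_open[OF DERIV_const J s(1)], simp add: const)+
    then have "cos (coord 2 p) * G p = 0" "sin (coord 2 p) * G p = 0"
      using DERIV_unique[OF has_velocity_sin_cos_coord(1)[OF v, of 2] d(1)]
        DERIV_unique[OF has_velocity_sin_cos_coord(2)[OF v, of 2] d(2)] s
      by (simp_all add: axis_def)
    moreover have "cos (coord 2 p) \<noteq> 0 \<or> sin (coord 2 p) \<noteq> 0"
      using sin_cos_squared_add[of "coord 2 p"] by (auto simp: power2_eq_square)
    ultimately show "G p = 0" by auto
  qed
qed

end

text \<open>An injective map preserves the property of a line to be a single point.\<close>

lemma zeros_correspond:
  assumes "shear_profile G H" "shear_profile G' H'" "inj h"
    and lines: "\<forall>L\<in>integral_lines (\<lambda>p. axis 2 (G p)). h ` L \<in> integral_lines (\<lambda>p. axis 2 (G' p))"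
  shows "G p = 0 \<longleftrightarrow> G' (h p) = 0"
proof -
  obtain L where L: "L \<in> integral_lines (\<lambda>p. axis 2 (G p))" "p \<in> L"
    using shear_profile.line_through[OF assms(1)] by blast
  have "L = {p} \<longleftrightarrow> h ` L = {h p}"
    using inj_image_eq_iff[OF assms(3), of L "{p}"] by simp
  then show ?thesis
    using shear_profile.line_singleton_iff[OF assms(1) L] L
      shear_profile.line_singleton_iff[OF assms(2), of "h ` L" "h p"] lines by blast
qed

section \<open>Counting circles of zeros\<close>

lemma continuous_on_torus_of: "continuous_on S torus_of"
proof -
  have "continuous_on UNIV torus_of"
    by (auto simp: continuous_on_open_vimage open_torus_def)
  then show ?thesis by (rule continuous_on_subset) simp
qed

lemma continuous_on_cos_coord: "continuous_on UNIV (\<lambda>p. cos (coord i p))"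
proof -
  have "open (torus_of -` (\<lambda>p. cos (coord i p)) -` U)" if "open U" for U
  proof -
    have "open ((\<lambda>x :: real ^ 2. cos (x $ i)) -` U)"
      using that by (intro open_vimage continuous_intros)
    moreover have "torus_of -` (\<lambda>p. cos (coord i p)) -` U = (\<lambda>x. cos (x $ i)) -` U"
      by (auto simp: sin_cos_coord_torus_of)
    ultimately show ?thesis by simp
  qed
  then show ?thesis by (auto simp: continuous_on_open_vimage open_torus_def)
qed

lemma continuous_on_vertical_circle: "continuous_on UNIV (\<lambda>y. torus_pt a y)"
proof -
  have "continuous_on UNIV (\<lambda>y. (\<lambda>(x, y). vector [x, y] :: real ^ 2) (a, y))"
    by (rule continuous_on_compose2[OF continuous_on_torus_pt_lift[of UNIV]]) (auto intro: continuous_intros)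
  then show ?thesis
    unfolding torus_pt_def by (intro continuous_on_compose2[OF continuous_on_torus_of[of UNIV]]) auto
qed

lemma sin_coord_zeros:
  assumes "sin (coord 1 p) = 0"
  obtains a y where "a \<in> {0, pi}" "p = torus_pt a y"
proof -
  obtain x y where p: "p = torus_pt x y" by (rule torus_pt_in_box)
  then have "sin x = 0" using assms by (simp add: sin_cos_coord_torus_pt)
  then have "cos x = 1 \<or> cos x = -1"
    using sin_cos_squared_add[of x] by (simp add: power2_eq_1_iff)
  then obtain a where a: "a \<in> {0, pi}" "sin a = sin x" "cos a = cos x"
    using \<open>sin x = 0\<close> that[of 0] that[of pi] by force
  have "p = torus_pt a y"
    unfolding p
  proof (rule torus_eqI)
    fix i :: 2
    show "sin (coord i (torus_pt x y)) = sin (coord i (torus_pt a y))"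
      "cos (coord i (torus_pt x y)) = cos (coord i (torus_pt a y))"
      using a exhaust_2[of i] by (auto simp: sin_cos_coord_torus_pt)
  qed
  then show thesis using that a by blast
qed

text \<open>The zero set of \<open>sin x\<^sub>1 (\<kappa> + cos x\<^sub>1)\<close> is a union of four circles, on which \<open>cos x\<^sub>1\<close> takes three values;
  the zero set of \<open>sin x\<^sub>1\<close> is a union of two.  Transported by \<open>h'\<close>, \<open>cos x\<^sub>1\<close> is a continuous function
  with finitely many values on each of the two circles, hence constant there.\<close>

lemma no_four_circles_onto_two:
  assumes h: "homeomorphism UNIV UNIV h h'" and \<kappa>: "0 < \<kappa>" "\<kappa> < 1"
    and zeros: "\<And>p. sin (coord 1 p) * (\<kappa> + cos (coord 1 p)) = 0 \<longleftrightarrow> sin (coord 1 (h p)) = 0"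
  shows False
proof -
  define m where "m q = cos (coord 1 (h' q))" for q
  have hh': "h (h' q) = q" "h' (h p) = p" for p q
    using h by (auto simp: homeomorphism_def)
  have const: "m (torus_pt a y) = m (torus_pt a y')" if "a \<in> {0, pi}" for a y y'
  proof -
    let ?M = "range (\<lambda>y. m (torus_pt a y))"
    have "continuous_on UNIV (\<lambda>y. m (torus_pt a y))"
      unfolding m_def
      by (rule continuous_on_compose2[OF continuous_on_cos_coord
           continuous_on_compose2[OF homeomorphism_cont2[OF h] continuous_on_vertical_circle]]) auto
    then have "connected ?M" by (rule connected_continuous_image) simp
    moreover have "?M \<subseteq> {1, -1, -\<kappa>}"
    proof (rule image_subsetI)
      fix z
      let ?p = "h' (torus_pt a z)"
      have "sin (coord 1 ?p) * (\<kappa> + cos (coord 1 ?p)) = 0"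
        using that unfolding zeros hh'(1) by (auto simp: sin_cos_coord_torus_pt)
      moreover have "cos (coord 1 ?p) = 1 \<or> cos (coord 1 ?p) = -1" if "sin (coord 1 ?p) = 0"
        using sin_cos_squared_add[of "coord 1 ?p"] that by (simp add: power2_eq_1_iff)
      ultimately show "m (torus_pt a z) \<in> {1, -1, -\<kappa>}" by (auto simp: m_def add_eq_0_iff)
    qed
    then have "finite ?M" by (rule finite_subset) simp
    ultimately obtain c where "?M = {c}"
      using connected_finite_iff_sing by blast
    then show ?thesis by (metis rangeI singletonD)
  qed
  have "\<exists>a\<in>{0, pi}. m (torus_pt a 0) = cos x" if "sin x * (\<kappa> + cos x) = 0" for x
  proof -
    have "sin (coord 1 (h (torus_pt x 0))) = 0"
      using zeros[of "torus_pt x 0"] that by (simp add: sin_cos_coord_torus_pt)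
    then obtain a y where a: "a \<in> {0, pi}" "h (torus_pt x 0) = torus_pt a y"
      by (rule sin_coord_zeros)
    then have "m (torus_pt a y) = cos x"
      by (metis hh'(2) m_def sin_cos_coord_torus_pt(2))
    then show ?thesis using a const by metis
  qed
  from this[of 0] this[of pi] this[of "arccos (- \<kappa>)"]
  have "1 \<in> {m (torus_pt 0 0), m (torus_pt pi 0)}" "-1 \<in> {m (torus_pt 0 0), m (torus_pt pi 0)}"
    "-\<kappa> \<in> {m (torus_pt 0 0), m (torus_pt pi 0)}"
    using \<kappa> by auto
  then show False using \<kappa> by auto
qed

section \<open>The two-mode magnetic field\<close>

text \<open>The summands are eigenfunctions of the Laplacian for the eigenvalues \<open>-1\<close> and \<open>-4\<close>, since
  \<open>sin x\<^sub>1 cos x\<^sub>1\<close> is half of \<open>sin (2 x\<^sub>1)\<close>; the exponentials are their decay under the heat flow.\<close>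

definition two_mode :: "real \<Rightarrow> real \<Rightarrow> real \<Rightarrow> torus \<Rightarrow> real" where
  "two_mode \<kappa> \<eta> t p = exp (- \<eta> * t) * (\<kappa> * sin (coord 1 p)) + exp (- 4 * \<eta> * t) * (sin (coord 1 p) * cos (coord 1 p))"

lemma two_mode_smooth: "spacetime_smooth (two_mode \<kappa> \<eta>)"
proof -
  have "spacetime_smooth (\<lambda>t p. two_mode \<kappa> \<eta> t p)"
    unfolding two_mode_def
    by (intro spacetime_smooth_add spacetime_smooth_mult spacetime_smooth_exp
        spacetime_smooth_of_torus_smooth torus_smooth_mult torus_smooth_const torus_smooth_sin_cos_coord)
  then show ?thesis .
qed

lemma two_mode_pderiv:
  "pderiv_torus 1 (two_mode \<kappa> \<eta> t) = (\<lambda>p. exp (- \<eta> * t) * (\<kappa> * cos (coord 1 p))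
     + exp (- 4 * \<eta> * t) * (cos (coord 1 p) * cos (coord 1 p) + (-1) * (sin (coord 1 p) * sin (coord 1 p))))"
  "pderiv_torus 2 (two_mode \<kappa> \<eta> t) = (\<lambda>p. 0)"
  unfolding two_mode_def fun_eq_iff
  by (simp_all add: pderiv_torus_add pderiv_torus_mult pderiv_torus_const pderiv_torus_sin_cos_coord
       torus_smooth_add torus_smooth_mult torus_smooth_const torus_smooth_sin_cos_coord)

lemma two_mode_heat:
  assumes "t \<ge> 0"
  shows "time_deriv (two_mode \<kappa> \<eta>) t p = \<eta> * laplacian (two_mode \<kappa> \<eta> t) p"
proof -
  have "laplacian (two_mode \<kappa> \<eta> t) p = - (exp (- \<eta> * t) * (\<kappa> * sin (coord 1 p)))
     - 4 * (exp (- 4 * \<eta> * t) * (sin (coord 1 p) * cos (coord 1 p)))"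
    unfolding laplacian_def sum_2 two_mode_pderiv
    by (simp only: pderiv_torus_add pderiv_torus_mult pderiv_torus_const pderiv_torus_sin_cos_coord
       torus_smooth_add torus_smooth_mult torus_smooth_const torus_smooth_sin_cos_coord)
      simp
  moreover have "((\<lambda>s. two_mode \<kappa> \<eta> s p) has_real_derivative (- \<eta>) * (exp (- \<eta> * t) * (\<kappa> * sin (coord 1 p)))
     + (- 4 * \<eta>) * (exp (- 4 * \<eta> * t) * (sin (coord 1 p) * cos (coord 1 p)))) (at t within {0..})"
    unfolding two_mode_def by (auto intro!: derivative_eq_intros)
  then have "time_deriv (two_mode \<kappa> \<eta>) t p = (- \<eta>) * (exp (- \<eta> * t) * (\<kappa> * sin (coord 1 p)))
     + (- 4 * \<eta>) * (exp (- 4 * \<eta> * t) * (sin (coord 1 p) * cos (coord 1 p)))"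
    using assms by (intro time_deriv_eqI) (simp_all flip: has_real_derivative_iff_has_vector_derivative)
  ultimately show ?thesis by (simp only:) (simp add: algebra_simps)
qed

lemma two_mode_slope_bound:
  assumes "\<eta> > 0" "t \<ge> 0" "0 \<le> \<kappa>" "\<kappa> \<le> 1"
  shows "\<bar>pderiv_torus 1 (two_mode \<kappa> \<eta> t) p\<bar> \<le> 2"
proof -
  let ?x = "coord 1 p"
  have "\<bar>exp (- \<eta> * t) * (\<kappa> * cos ?x)\<bar> \<le> 1 * (1 * 1)"
    unfolding abs_mult using assms by (intro mult_mono) auto
  moreover have "\<bar>exp (- 4 * \<eta> * t) * cos (2 * ?x)\<bar> \<le> 1 * 1"
    unfolding abs_mult using assms by (intro mult_mono) auto
  moreover have "cos ?x * cos ?x + (-1) * (sin ?x * sin ?x) = cos (2 * ?x)"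
    using cos_add[of ?x ?x] by simp
  ultimately show ?thesis
    unfolding two_mode_pderiv by (simp add: abs_le_iff)
qed

text \<open>The reflection \<open>x \<mapsto> (2 \<pi>, 2 \<pi>) - x\<close> maps the fundamental square onto itself and acts on the torus
  as \<open>x \<mapsto> - x\<close>, so the integral equals its own negative.\<close>

lemma zero_average_of_odd:
  fixes f :: "torus \<Rightarrow> real ^ 2"
  assumes odd: "\<And>x. f (torus_of (- x)) = - f (torus_of x)"
  shows "zero_average f"
proof -
  let ?c = "(\<chi> i. 2 * pi) :: real ^ 2" and ?I = "torus_integral f"
  have "torus_of (?c - x) = torus_of (- x)" for x
    unfolding torus_of_eq_iff torus_rel_def by (auto intro: exI[of _ 1])
  then have refl: "f (torus_of (?c - x)) = - f (torus_of x)" for x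
    using odd[of x] by simp
  show ?thesis
  proof (cases "(\<lambda>x. f (torus_of x)) integrable_on cbox 0 ?c")
    case True
    then have I: "((\<lambda>x. f (torus_of x)) has_integral ?I) (cbox 0 ?c)"
      unfolding torus_integral_def by (rule integrable_integral)
    from has_integral_affinity[OF I, of "-1" ?c]
    have "((\<lambda>x. - f (torus_of x)) has_integral ?I) ((\<lambda>x. - x + ?c) ` cbox 0 ?c)"
      by (simp add: refl)
    moreover have "(\<lambda>x. - x + ?c) ` cbox 0 ?c = cbox 0 ?c"
    proof (intro equalityI subsetI)
      fix x assume "x \<in> cbox 0 ?c"
      then show "x \<in> (\<lambda>x. - x + ?c) ` cbox 0 ?c"
        by (intro image_eqI[of _ _ "?c - x"]) (auto simp: mem_box_cart)
    qed (auto simp: mem_box_cart)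
    ultimately have "((\<lambda>x. - f (torus_of x)) has_integral ?I) (cbox 0 ?c)" by simp
    from has_integral_neg[OF this] have "((\<lambda>x. f (torus_of x)) has_integral - ?I) (cbox 0 ?c)"
      by simp
    with I have "?I = - ?I" by (rule has_integral_unique)
    then have "?I $ i = - (?I $ i)" for i
      by (metis vector_uminus_component)
    then have "?I $ i = 0" for i
      by (metis equal_neg_zero)
    then show ?thesis unfolding zero_average_def by (simp add: vec_eq_iff)
  next
    case False
    then show ?thesis unfolding zero_average_def torus_integral_def by (rule not_integrable_integral)
  qed
qed

theorem theorem1p1:
  fixes \<nu> \<eta> T :: real
  assumes "\<nu> > 0" and "\<eta> > 0" and "T > 0"
  shows "\<exists>b0 :: torus \<Rightarrow> real ^ 2.
           torus_smooth b0 \<and> (\<forall>p. divergence b0 p = 0) \<and> zero_average b0 \<and>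
           (\<exists>u b. global_smooth_MHD_solution \<nu> \<eta> (\<lambda>p. 0) b0 u b \<and>
              (\<forall>u' b'. global_smooth_MHD_solution \<nu> \<eta> (\<lambda>p. 0) b0 u' b' \<longrightarrow>
                 (\<forall>t\<ge>0. u' t = u t \<and> b' t = b t)) \<and>
              \<not> lines_topologically_equivalent (b 0) (b T))"
proof -
  define \<kappa> where "\<kappa> = exp (- 3 * \<eta> * T)"
  have \<kappa>: "0 < \<kappa>" "\<kappa> < 1" using assms by (auto simp: \<kappa>_def)
  define g where "g = two_mode \<kappa> \<eta>"
  define b where "b t p = (axis 2 (g t p) :: real ^ 2)" for t p
  have sol: "global_smooth_MHD_solution \<nu> \<eta> (\<lambda>p. 0) (b 0) (\<lambda>t p. 0) b"
    unfolding b_def[abs_def] g_def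
    by (rule shear_is_solution) (auto intro: two_mode_smooth two_mode_heat simp: two_mode_pderiv)
  have unique: "u' t = (\<lambda>p. 0) \<and> b' t = b t"
    if "global_smooth_MHD_solution \<nu> \<eta> (\<lambda>p. 0) (b 0) u' b'" "t \<ge> 0" for u' b' t
  proof -
    have "global_smooth_MHD_solution \<nu> \<eta> (\<lambda>p. 0) (\<lambda>p. axis 2 (g 0 p)) u' b'"
      using that(1) by (simp add: b_def[abs_def])
    note unique = shear_solution_unique[where g = g and C = 2 and ?t0.0 = t, OF this]
    have "u' t = (\<lambda>p. 0)" "b' t = (\<lambda>p. axis 2 (g t p))"
      by (rule unique;
          use that(2) assms \<kappa> in \<open>simp add: g_def two_mode_smooth two_mode_heat two_mode_slope_bound two_mode_pderiv(2)\<close>)+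
    then show ?thesis by (simp add: b_def[abs_def])
  qed
  have average: "zero_average (b 0)"
    by (rule zero_average_of_odd)
      (simp add: b_def g_def two_mode_def sin_cos_coord_torus_of vec_eq_iff axis_def)
  have g_zero: "g t p = 0 \<longleftrightarrow> sin (coord 1 p) * (\<kappa> * exp (3 * \<eta> * t) + cos (coord 1 p)) = 0" for t p
  proof -
    have "exp (- \<eta> * t) = exp (- 4 * \<eta> * t) * exp (3 * \<eta> * t)"
      by (simp flip: exp_add)
    then have "g t p = exp (- 4 * \<eta> * t) * (sin (coord 1 p) * (\<kappa> * exp (3 * \<eta> * t) + cos (coord 1 p)))"
      by (simp add: g_def two_mode_def algebra_simps)
    then show ?thesis by simp
  qed
  \<comment> \<open>At time T the factor \<kappa> exp (3 \<eta> T) + cos vanishes only where the sine does.\<close>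
  have "\<kappa> * exp (3 * \<eta> * T) = 1"
    by (simp add: \<kappa>_def flip: exp_add)
  then have gT_zero: "g T p = 0 \<longleftrightarrow> sin (coord 1 p) = 0" for p
  proof -
    have "sin (coord 1 p) = 0" if "1 + cos (coord 1 p) = 0"
    proof -
      have "cos (coord 1 p) = -1" using that by simp
      then have "(sin (coord 1 p))\<^sup>2 = 0" by (simp add: sin_squared_eq)
      then show ?thesis by simp
    qed
    then show ?thesis
      unfolding g_zero \<open>\<kappa> * exp (3 * \<eta> * T) = 1\<close> by auto
  qed
  have "\<not> lines_topologically_equivalent (b 0) (b T)"
  proof
    assume "lines_topologically_equivalent (b 0) (b T)"
    then obtain h h' where h: "homeomorphism UNIV UNIV h h'"
      and lines: "\<forall>L\<in>integral_lines (b 0). h ` L \<in> integral_lines (b T)"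
      unfolding lines_topologically_equivalent_def by blast
    have "shear_profile (g t) (\<lambda>s c. exp (- \<eta> * t) * (\<kappa> * s) + exp (- 4 * \<eta> * t) * (s * c))" for t
      by unfold_locales (simp add: g_def two_mode_def)
    moreover have "inj h" using h unfolding homeomorphism_def by (metis UNIV_I injI)
    ultimately have "g 0 p = 0 \<longleftrightarrow> g T (h p) = 0" for p
      using lines unfolding b_def[abs_def] by (intro zeros_correspond)
    then show False
      using no_four_circles_onto_two[OF h \<kappa>] g_zero[of 0] gT_zero by simp
  qed
  moreover have "torus_smooth (b 0)" "\<forall>p. divergence (b 0) p = 0"
    using sol spacetime_smooth_slice[of b 0] unfolding global_smooth_MHD_solution_def by auto
  ultimately show ?thesis using sol unique average by blast
qed

end
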